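(* Let $(M^{n+m}=B^n\times_f F^m,\ g=g_B+f^2g_F,\ h,\ \rho)$ be a warped product Yamabe gradient soliton with noncompact base $B$. If $\operatorname{Hess} f=c\,f\,g_B$ on $B$ for some nonzero constant $c$, then $(M^{n+m},g)$ is a trivial Yamabe gradient soliton (i.e. $h$ is constant). Moreover, the warped product $(M^{n+m},g)$ has constant scalar curvature.
   Context: A Riemannian metric $g$ on a connected smooth manifold $M$ is a Yamabe gradient soliton, denoted $(M,g,h,\rho)$, if there are a smooth function $h:M\to\mathbb{R}$ (the soliton function) and a constant $\rho\in\mathbb{R}$ with $\operatorname{Hess} h=(R-\rho)g$ on $M$, where $R$ is the scalar curvature of $g$. It is trivial if $h$ is constant, and nontrivial otherwise. Given Riemannian manifolds $(B^n,g_B)$ (the base) and $(F^m,g_F)$ (the fiber) and a nonconstant positive smooth function $f:B\to(0,\infty)$ (the warping function), the warped product $M=B\times_f F$ is $B\times F$ with the metric $g=\pi^*g_B+(f\circ\pi)^2\eta^*g_F$, where $\pi:M\to B$ and $\eta:M\to F$ are the projections; this is written $g=g_B+f^2g_F$. A warped product Yamabe gradient soliton is a Yamabe gradient soliton $(M,g,h,\rho)$ such that $(M,g)$ is a warped product of this kind. Completeness of the metrics is not assumed. $\operatorname{Hess} f$ denotes the Hessian of $f$ on $(B,g_B)$. *)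

theory Defs
  imports "HOL-Analysis.Analysis"
begin

section \<open>Smooth functions on open subsets of Euclidean spaces\<close>

text \<open>\<open>S\<close> is meant to be open; \<open>C_on k S f\<close> says that \<open>f\<close> is of class $C^k$ on \<open>S\<close>.\<close>

primrec C_on :: "nat \<Rightarrow> 'a::euclidean_space set \<Rightarrow> ('a \<Rightarrow> 'b::real_normed_vector) \<Rightarrow> bool" where
  "C_on 0 S f \<longleftrightarrow> continuous_on S f"
| "C_on (Suc k) S f \<longleftrightarrow>
     (\<forall>x\<in>S. f differentiable (at x)) \<and>
     (\<forall>v. C_on k S (\<lambda>x. frechet_derivative f (at x) v))"

definition smooth_on :: "'a::euclidean_space set \<Rightarrow> ('a \<Rightarrow> 'b::real_normed_vector) \<Rightarrow> bool" where
  "smooth_on S f \<longleftrightarrow> (\<forall>k. C_on k S f)"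


section \<open>Smooth manifolds\<close>

text \<open>A manifold modelled on the Euclidean space \<open>'e\<close> (so of dimension \<open>DIM('e)\<close>, which is
  arbitrary but positive) is a topology with a smooth atlas. The atlas need not be maximal: all
  notions below that quantify over charts do not depend on the choice of the atlas within its
  smooth structure. Functions on the manifold are only relevant on the carrier \<open>points M\<close>.\<close>

type_synonym ('p, 'e) chart = "'p set \<times> ('p \<Rightarrow> 'e)"

record ('p, 'e) manifold =
  topo :: "'p topology"
  atlas :: "('p, 'e) chart set"

abbreviation points :: "('p, 'e) manifold \<Rightarrow> 'p set" where
  "points M \<equiv> topspace (topo M)"

definition chart_inv :: "('p, 'e) chart \<Rightarrow> 'e \<Rightarrow> 'p" where
  "chart_inv c = inv_into (fst c) (snd c)"

definition smooth_manifold :: "('p, 'e::euclidean_space) manifold \<Rightarrow> bool" where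
  "smooth_manifold M \<longleftrightarrow>
     Hausdorff_space (topo M) \<and> second_countable (topo M) \<and>
     (\<Union>c\<in>atlas M. fst c) = points M \<and>
     (\<forall>c\<in>atlas M. openin (topo M) (fst c) \<and> open (snd c ` fst c) \<and>
        homeomorphic_map (subtopology (topo M) (fst c)) (top_of_set (snd c ` fst c)) (snd c)) \<and>
     (\<forall>c\<in>atlas M. \<forall>d\<in>atlas M. smooth_on (snd c ` (fst c \<inter> fst d)) (snd d \<circ> chart_inv c))"

definition smooth_fun_on :: "('p, 'e::euclidean_space) manifold \<Rightarrow> 'p set \<Rightarrow> ('p \<Rightarrow> real) \<Rightarrow> bool" where
  "smooth_fun_on M U f \<longleftrightarrow>
     (\<forall>c\<in>atlas M. smooth_on (snd c ` (U \<inter> fst c)) (f \<circ> chart_inv c))"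

definition smooth_at :: "('p, 'e::euclidean_space) manifold \<Rightarrow> 'p \<Rightarrow> ('p \<Rightarrow> real) \<Rightarrow> bool" where
  "smooth_at M p f \<longleftrightarrow> (\<exists>U. openin (topo M) U \<and> p \<in> U \<and> smooth_fun_on M U f)"

definition product_manifold ::
    "('p, 'a) manifold \<Rightarrow> ('q, 'b) manifold \<Rightarrow> ('p \<times> 'q, 'a \<times> 'b) manifold" where
  "product_manifold B F =
     \<lparr>topo = prod_topology (topo B) (topo F),
      atlas = {(fst c \<times> fst d, map_prod (snd c) (snd d)) |c d. c \<in> atlas B \<and> d \<in> atlas F}\<rparr>"


section \<open>Tangent vectors\<close>

text \<open>Tangent vectors at \<open>p\<close> are the derivations at \<open>p\<close> of the functions that are smooth near \<open>p\<close>;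
  by convention they vanish on all other functions, so that equality of tangent vectors is
  equality of functionals. That a derivation depends only on the germ of its argument follows
  from the Leibniz rule.\<close>

type_synonym 'p tvec = "('p \<Rightarrow> real) \<Rightarrow> real"

definition tangent_space :: "('p, 'e::euclidean_space) manifold \<Rightarrow> 'p \<Rightarrow> 'p tvec set" where
  "tangent_space M p = {X.
     (\<forall>f. \<not> smooth_at M p f \<longrightarrow> X f = 0) \<and>
     (\<forall>f g a. smooth_at M p f \<and> smooth_at M p g \<longrightarrow>
        X (\<lambda>q. a * f q + g q) = a * X f + X g \<and>
        X (\<lambda>q. f q * g q) = f p * X g + g p * X f)}"

text \<open>For a basis vector \<open>i\<close> of \<open>'e\<close>, \<open>coord_vec M c p i\<close> is the coordinate vector
  $\partial_i|_p$ of the chart \<open>c\<close>.\<close>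

definition coord_vec ::
    "('p, 'e::euclidean_space) manifold \<Rightarrow> ('p, 'e) chart \<Rightarrow> 'p \<Rightarrow> 'e \<Rightarrow> 'p tvec" where
  "coord_vec M c p v = (\<lambda>f. if smooth_at M p f
     then frechet_derivative (f \<circ> chart_inv c) (at (snd c p)) v else 0)"

definition pushforward ::
    "('q, 'b::euclidean_space) manifold \<Rightarrow> ('p \<Rightarrow> 'q) \<Rightarrow> 'p \<Rightarrow> 'p tvec \<Rightarrow> 'q tvec" where
  "pushforward N \<pi> p X = (\<lambda>f. if smooth_at N (\<pi> p) f then X (f \<circ> \<pi>) else 0)"


section \<open>Riemannian metrics\<close>

type_synonym 'p metric = "'p \<Rightarrow> 'p tvec \<Rightarrow> 'p tvec \<Rightarrow> real"

text \<open>\<open>metric_in M g c x\<close> is the coordinate expression of \<open>g\<close> at the point of the chart \<open>c\<close>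
  with coordinates \<open>x\<close>.\<close>

definition metric_in ::
    "('p, 'e::euclidean_space) manifold \<Rightarrow> 'p metric \<Rightarrow> ('p, 'e) chart \<Rightarrow> 'e \<Rightarrow> 'e \<Rightarrow> 'e \<Rightarrow> real" where
  "metric_in M g c x u v =
     g (chart_inv c x) (coord_vec M c (chart_inv c x) u) (coord_vec M c (chart_inv c x) v)"

definition riemannian_metric :: "('p, 'e::euclidean_space) manifold \<Rightarrow> 'p metric \<Rightarrow> bool" where
  "riemannian_metric M g \<longleftrightarrow>
     (\<forall>p\<in>points M.
        (\<forall>X\<in>tangent_space M p. \<forall>Y\<in>tangent_space M p. g p X Y = g p Y X) \<and>
        (\<forall>X\<in>tangent_space M p. \<forall>Y\<in>tangent_space M p. \<forall>Z\<in>tangent_space M p. \<forall>a.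
           g p (\<lambda>f. a * X f + Y f) Z = a * g p X Z + g p Y Z) \<and>
        (\<forall>X\<in>tangent_space M p. X \<noteq> (\<lambda>f. 0) \<longrightarrow> g p X X > 0)) \<and>
     (\<forall>c\<in>atlas M. \<forall>i\<in>Basis. \<forall>j\<in>Basis.
        smooth_on (snd c ` fst c) (\<lambda>x. metric_in M g c x i j))"

definition riemannian_manifold :: "('p, 'e::euclidean_space) manifold \<Rightarrow> 'p metric \<Rightarrow> bool" where
  "riemannian_manifold M g \<longleftrightarrow> smooth_manifold M \<and> riemannian_metric M g"

definition pullback ::
    "('q, 'b::euclidean_space) manifold \<Rightarrow> ('p \<Rightarrow> 'q) \<Rightarrow> 'q metric \<Rightarrow> 'p metric" where
  "pullback N \<pi> g p X Y = g (\<pi> p) (pushforward N \<pi> p X) (pushforward N \<pi> p Y)"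

definition warped_metric ::
    "('p, 'a::euclidean_space) manifold \<Rightarrow> ('q, 'b::euclidean_space) manifold \<Rightarrow> ('p \<Rightarrow> real) \<Rightarrow>
     'p metric \<Rightarrow> 'q metric \<Rightarrow> ('p \<times> 'q) metric" where
  "warped_metric B F f gB gF p X Y =
     pullback B fst gB p X Y + ((f \<circ> fst) p)\<^sup>2 * pullback F snd gF p X Y"


section \<open>Hessian and scalar curvature in coordinates\<close>

text \<open>\<open>G x i j\<close> stands for $g_{ij}(x)$, with indices \<open>i\<close>, \<open>j\<close> ranging over \<open>Basis\<close>.\<close>

abbreviation partial :: "'e::euclidean_space \<Rightarrow> ('e \<Rightarrow> real) \<Rightarrow> 'e \<Rightarrow> real" where
  "partial i F x \<equiv> frechet_derivative F (at x) i"

text \<open>$g^{ij}$: the matrix of the inverse of the linear map with matrix $(g_{ij})$.\<close>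

definition inv_metric :: "('e::euclidean_space \<Rightarrow> 'e \<Rightarrow> 'e \<Rightarrow> real) \<Rightarrow> 'e \<Rightarrow> 'e \<Rightarrow> 'e \<Rightarrow> real" where
  "inv_metric G x i j = inv (\<lambda>v. \<Sum>k\<in>Basis. (\<Sum>l\<in>Basis. G x k l * (v \<bullet> l)) *\<^sub>R k) i \<bullet> j"

text \<open>\<open>christoffel G k i j x\<close> is $\Gamma^k_{ij}(x)$.\<close>

definition christoffel ::
    "('e::euclidean_space \<Rightarrow> 'e \<Rightarrow> 'e \<Rightarrow> real) \<Rightarrow> 'e \<Rightarrow> 'e \<Rightarrow> 'e \<Rightarrow> 'e \<Rightarrow> real" where
  "christoffel G k i j x = (1 / 2) * (\<Sum>l\<in>Basis. inv_metric G x k l *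
     (partial i (\<lambda>y. G y j l) x + partial j (\<lambda>y. G y i l) x - partial l (\<lambda>y. G y i j) x))"

text \<open>The trace of the curvature tensor, with the sign for which round spheres have positive
  Ricci curvature.\<close>

definition coord_ricci ::
    "('e::euclidean_space \<Rightarrow> 'e \<Rightarrow> 'e \<Rightarrow> real) \<Rightarrow> 'e \<Rightarrow> 'e \<Rightarrow> 'e \<Rightarrow> real" where
  "coord_ricci G x j k =
     (\<Sum>i\<in>Basis. partial i (christoffel G i j k) x - partial j (christoffel G i i k) x
       + (\<Sum>l\<in>Basis. christoffel G i i l x * christoffel G l j k x
                     - christoffel G i j l x * christoffel G l i k x))"

definition coord_scalar :: "('e::euclidean_space \<Rightarrow> 'e \<Rightarrow> 'e \<Rightarrow> real) \<Rightarrow> 'e \<Rightarrow> real" where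
  "coord_scalar G x = (\<Sum>j\<in>Basis. \<Sum>k\<in>Basis. inv_metric G x j k * coord_ricci G x j k)"

definition coord_hessian ::
    "('e::euclidean_space \<Rightarrow> 'e \<Rightarrow> 'e \<Rightarrow> real) \<Rightarrow> ('e \<Rightarrow> real) \<Rightarrow> 'e \<Rightarrow> 'e \<Rightarrow> 'e \<Rightarrow> real" where
  "coord_hessian G F x i j =
     partial i (partial j F) x - (\<Sum>k\<in>Basis. christoffel G k i j x * partial k F x)"

text \<open>\<open>hessian M g h c p i j\<close> is $(\mathrm{Hess}\, h)(\partial_i, \partial_j)$ at \<open>p\<close> for the
  coordinate vectors of the chart \<open>c\<close>. The value of \<open>scalar_curvature M g c p\<close> does not depend on
  the chart \<open>c\<close> around \<open>p\<close>, being a full contraction of a tensor; the chart only says which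
  coordinates are used to compute it.\<close>

definition hessian ::
    "('p, 'e::euclidean_space) manifold \<Rightarrow> 'p metric \<Rightarrow> ('p \<Rightarrow> real) \<Rightarrow> ('p, 'e) chart \<Rightarrow>
     'p \<Rightarrow> 'e \<Rightarrow> 'e \<Rightarrow> real" where
  "hessian M g h c p i j = coord_hessian (metric_in M g c) (h \<circ> chart_inv c) (snd c p) i j"

definition scalar_curvature ::
    "('p, 'e::euclidean_space) manifold \<Rightarrow> 'p metric \<Rightarrow> ('p, 'e) chart \<Rightarrow> 'p \<Rightarrow> real" where
  "scalar_curvature M g c p = coord_scalar (metric_in M g c) (snd c p)"

definition constant_scalar_curvature :: "('p, 'e::euclidean_space) manifold \<Rightarrow> 'p metric \<Rightarrow> bool" where
  "constant_scalar_curvature M g \<longleftrightarrow>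
     (\<exists>k. \<forall>c\<in>atlas M. \<forall>p\<in>fst c. scalar_curvature M g c p = k)"


section \<open>Yamabe gradient solitons\<close>

definition yamabe_gradient_soliton ::
    "('p, 'e::euclidean_space) manifold \<Rightarrow> 'p metric \<Rightarrow> ('p \<Rightarrow> real) \<Rightarrow> real \<Rightarrow> bool" where
  "yamabe_gradient_soliton M g h \<rho> \<longleftrightarrow>
     riemannian_manifold M g \<and> connected_space (topo M) \<and> smooth_fun_on M (points M) h \<and>
     (\<forall>c\<in>atlas M. \<forall>p\<in>fst c. \<forall>i\<in>Basis. \<forall>j\<in>Basis.
        hessian M g h c p i j =
          (scalar_curvature M g c p - \<rho>) * g p (coord_vec M c p i) (coord_vec M c p j))"

definition trivial_yamabe_gradient_soliton ::
    "('p, 'e::euclidean_space) manifold \<Rightarrow> 'p metric \<Rightarrow> ('p \<Rightarrow> real) \<Rightarrow> real \<Rightarrow> bool" where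
  "trivial_yamabe_gradient_soliton M g h \<rho> \<longleftrightarrow>
     yamabe_gradient_soliton M g h \<rho> \<and> h constant_on points M"

definition warped_product_yamabe_gradient_soliton ::
    "('p, 'a::euclidean_space) manifold \<Rightarrow> 'p metric \<Rightarrow> ('q, 'b::euclidean_space) manifold \<Rightarrow>
     'q metric \<Rightarrow> ('p \<Rightarrow> real) \<Rightarrow> ('p \<times> 'q \<Rightarrow> real) \<Rightarrow> real \<Rightarrow> bool" where
  "warped_product_yamabe_gradient_soliton B gB F gF f h \<rho> \<longleftrightarrow>
     riemannian_manifold B gB \<and> riemannian_manifold F gF \<and>
     smooth_fun_on B (points B) f \<and> (\<forall>p\<in>points B. f p > 0) \<and> \<not> f constant_on points B \<and>
     yamabe_gradient_soliton (product_manifold B F) (warped_metric B F f gB gF) h \<rho>"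

end

theory Submission
  imports Defs
begin

text \<open>Write \<open>\<sigma> = R - \<rho>\<close>. The mixed components of \<open>Hess h = \<sigma> g\<close> say that a fiber derivative \<open>u\<close>
  of \<open>h\<close> satisfies \<open>f d\<^sub>B u = u df\<close>. Differentiating the base components along the fiber and the fiber
  components along the base, and using \<open>Hess f = c f g\<^sub>B\<close>, one gets \<open>d\<sigma> = c dh\<close> on the product.

  Hence \<open>V = grad h\<close> is a conformal field that lies in the kernel of \<open>K\<close>, the curvature tensor with
  that of constant curvature \<open>- c\<close> subtracted. The second Bianchi identity then gives
  \<open>V s = - 2 \<sigma> s\<close> for the trace \<open>s\<close> of \<open>K\<close>. Since \<open>s\<close> and \<open>\<sigma>\<close> differ by a constant, and
  \<open>d |V|\<^sup>2 = 2 \<sigma> dh\<close>, this makes \<open>|V|\<^sup>2\<close> a quadratic polynomial in \<open>\<sigma>\<close> whose derivative is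
  incompatible with \<open>dh \<noteq> 0\<close>. So \<open>dh = 0\<close>, and then \<open>\<sigma> = 0\<close>, that is \<open>R = \<rho>\<close>. Everything is
  local in a product chart, so no change of coordinates is ever needed.\<close>

section \<open>Directional derivatives and smoothness\<close>

text \<open>The function \<open>h\<close> may depend on the fiber, so there is no reduction to an
  equation on the base alone; the steps are identities between derivatives at single points of the
  product. The relation between \<open>\<sigma>\<close> and \<open>h\<close> matters because the
  covariant derivative of \<open>V\<close> is \<open>\<sigma>\<close> times the identity: commuting
  derivatives gives \<open>Rm u v V = d\<sigma>(u) v - d\<sigma>(v) u\<close>, and this is then
  exactly the value for constant curvature \<open>- c\<close>, hence the tensor subtracted. In the
  second Bianchi identity with \<open>V\<close> in one slot, two of the three terms differentiate an
  identity saying that \<open>K\<close> kills \<open>V\<close>; each moves the derivative to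
  \<open>V\<close> and costs one \<open>\<sigma>\<close>, whence the factor 2. With \<open>n\<close>
  the dimension of the product and \<open>\<kappa> = \<rho> + c n (n - 1)\<close>, the trace is
  \<open>\<sigma> + \<kappa>\<close> and the polynomial reads
  \<open>c |V|^2 = - 2 \<sigma> (\<sigma> + \<kappa>)\<close>. One derivative gives
  \<open>(6 \<sigma> + 2 \<kappa>) dh = 0\<close>; a second one, multiplied by \<open>dh\<close>,
  gives \<open>6 c (dh)^3 = 0\<close>, with no case distinction on zeros of \<open>dh\<close>.
  Tensors are kept as operator-valued functions, so that product rules replace most index
  sums.\<close>

abbreviation dd :: "'a::real_normed_vector \<Rightarrow> ('a \<Rightarrow> 'b::real_normed_vector) \<Rightarrow> 'a \<Rightarrow> 'b" where
  "dd v f x \<equiv> frechet_derivative f (at x) v"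

lemma dd_eqI: "(f has_derivative f') (at x) \<Longrightarrow> dd v f x = f' v"
  by (metis frechet_derivative_at)

lemma dd_add:
  "f differentiable at x \<Longrightarrow> g differentiable at x \<Longrightarrow> dd v (\<lambda>x. f x + g x) x = dd v f x + dd v g x"
  by (rule dd_eqI) (auto intro!: derivative_eq_intros simp: frechet_derivative_works)

lemma dd_diff:
  "f differentiable at x \<Longrightarrow> g differentiable at x \<Longrightarrow> dd v (\<lambda>x. f x - g x) x = dd v f x - dd v g x"
  by (rule dd_eqI) (auto intro!: derivative_eq_intros simp: frechet_derivative_works)

lemma differentiable_bilinear:
  "bounded_bilinear B \<Longrightarrow> f differentiable at x \<Longrightarrow> g differentiable at x
    \<Longrightarrow> (\<lambda>x. B (f x) (g x)) differentiable at x"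
  unfolding differentiable_def using bounded_bilinear.FDERIV by blast

lemma differentiable_linear:
  "bounded_linear L \<Longrightarrow> f differentiable at x \<Longrightarrow> (\<lambda>x. L (f x)) differentiable at x"
  unfolding differentiable_def using bounded_linear.has_derivative by blast

lemma dd_bilinear:
  assumes "bounded_bilinear B" "f differentiable at x" "g differentiable at x"
  shows "dd v (\<lambda>x. B (f x) (g x)) x = B (f x) (dd v g x) + B (dd v f x) (g x)"
  by (rule dd_eqI, rule bounded_bilinear.FDERIV[OF assms(1)])
     (use assms in \<open>auto simp: frechet_derivative_works\<close>)

lemma dd_linear:
  assumes "bounded_linear L" "f differentiable at x"
  shows "dd v (\<lambda>x. L (f x)) x = L (dd v f x)"
  by (rule dd_eqI, rule bounded_linear.has_derivative[OF assms(1)])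
     (use assms in \<open>auto simp: frechet_derivative_works\<close>)

lemma dd_sum:
  assumes "finite A" "\<And>i. i \<in> A \<Longrightarrow> f i differentiable at x"
  shows "dd v (\<lambda>x. \<Sum>i\<in>A. f i x) x = (\<Sum>i\<in>A. dd v (f i) x)"
  by (rule dd_eqI) (use assms in \<open>auto intro!: derivative_eq_intros simp: frechet_derivative_works\<close>)

lemma dd_direction_add: "f differentiable at x \<Longrightarrow> dd (u + v) f x = dd u f x + dd v f x"
  using linear_frechet_derivative linear_add by blast

lemma dd_direction_scale: "f differentiable at x \<Longrightarrow> dd (r *\<^sub>R v) f x = r *\<^sub>R dd v f x"
  using linear_frechet_derivative linear_cmul by blast

lemma dd_direction_zero: "f differentiable at x \<Longrightarrow> dd 0 f x = 0"
  using linear_frechet_derivative linear_0 by blast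

lemma has_derivative_cong_open:
  assumes "open S" "x \<in> S" "\<And>y. y \<in> S \<Longrightarrow> f y = g y"
  shows "(f has_derivative f') (at x) \<longleftrightarrow> (g has_derivative f') (at x)"
  using assms has_derivative_transform_within_open[of f f' x UNIV S g]
    has_derivative_transform_within_open[of g f' x UNIV S f] by auto

lemma dd_cong:
  assumes "open S" "x \<in> S" "\<And>y. y \<in> S \<Longrightarrow> f y = g y"
  shows "dd v f x = dd v g x"
  using has_derivative_cong_open[OF assms] by (simp add: frechet_derivative_def)

lemma differentiable_cong_open:
  assumes "open S" "x \<in> S" "\<And>y. y \<in> S \<Longrightarrow> f y = g y"
  shows "f differentiable at x \<longleftrightarrow> g differentiable at x"
  using has_derivative_cong_open[OF assms] by (simp add: differentiable_def)

lemma dd_compose_linear: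
  assumes "bounded_linear L" "f differentiable at (L x)"
  shows "dd v (\<lambda>x. f (L x)) x = dd (L v) f (L x)" "(\<lambda>x. f (L x)) differentiable at x"
proof -
  have "((\<lambda>x. f (L x)) has_derivative (\<lambda>v. dd (L v) f (L x))) (at x)"
    using has_derivative_compose[OF bounded_linear.has_derivative[OF assms(1) has_derivative_ident]]
      assms(2) by (auto simp: frechet_derivative_works)
  then show "dd v (\<lambda>x. f (L x)) x = dd (L v) f (L x)" "(\<lambda>x. f (L x)) differentiable at x"
    using dd_eqI by (blast, auto simp: differentiable_def)
qed

lemmas dd_fst = dd_compose_linear[OF bounded_linear_fst]
lemmas dd_snd = dd_compose_linear[OF bounded_linear_snd]

section \<open>Differentiability classes under linear and bilinear operations\<close>

lemma C_on_cong:
  assumes "open S"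
  shows "(\<And>x. x \<in> S \<Longrightarrow> f x = g x) \<Longrightarrow> C_on k S f \<longleftrightarrow> C_on k S g"
proof (induction k arbitrary: f g)
  case 0
  then show ?case by (simp cong: continuous_on_cong)
next
  case (Suc k)
  have "C_on k S (dd v f) \<longleftrightarrow> C_on k S (dd v g)" for v
    by (rule Suc.IH) (rule dd_cong[OF assms _ Suc.prems])
  moreover have "f differentiable at x \<longleftrightarrow> g differentiable at x" if "x \<in> S" for x
    using differentiable_cong_open[OF assms that Suc.prems] .
  ultimately show ?case by simp
qed

lemma C_on_subset: "C_on k S f \<Longrightarrow> T \<subseteq> S \<Longrightarrow> C_on k T f"
proof (induction k arbitrary: f)
  case 0
  then show ?case by (auto intro: continuous_on_subset)
next
  case (Suc k)
  then show ?case by (metis C_on.simps(2) in_mono)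
qed

lemma C_on_Suc_imp: "C_on (Suc k) S f \<Longrightarrow> C_on k S f"
proof (induction k arbitrary: f)
  case 0
  then show ?case
    by (auto intro: differentiable_imp_continuous_on simp: differentiable_on_def differentiable_at_withinI)
next
  case (Suc k)
  then show ?case by (metis C_on.simps(2))
qed

lemma C_on_const: "C_on k S (\<lambda>x. a)"
  by (induction k arbitrary: a) auto

lemma C_on_add:
  assumes "open S"
  shows "C_on k S f \<Longrightarrow> C_on k S g \<Longrightarrow> C_on k S (\<lambda>x. f x + g x)"
proof (induction k arbitrary: f g)
  case 0
  then show ?case by (auto intro: continuous_on_add)
next
  case (Suc k)
  have "C_on k S (dd v (\<lambda>x. f x + g x))" for v
  proof (subst C_on_cong[OF assms])
    show "dd v (\<lambda>x. f x + g x) x = dd v f x + dd v g x" if "x \<in> S" for x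
      using Suc.prems that by (intro dd_add) auto
    show "C_on k S (\<lambda>x. dd v f x + dd v g x)"
      using Suc by (intro Suc.IH) auto
  qed
  then show ?case using Suc.prems by auto
qed

lemma C_on_linear:
  assumes "open S" "bounded_linear L"
  shows "C_on k S f \<Longrightarrow> C_on k S (\<lambda>x. L (f x))"
proof (induction k arbitrary: f)
  case 0
  then show ?case by (auto intro: bounded_linear.continuous_on[OF assms(2)])
next
  case (Suc k)
  have "C_on k S (dd v (\<lambda>x. L (f x)))" for v
  proof (subst C_on_cong[OF assms(1)])
    show "dd v (\<lambda>x. L (f x)) x = L (dd v f x)" if "x \<in> S" for x
      using Suc.prems that assms by (intro dd_linear) auto
    show "C_on k S (\<lambda>x. L (dd v f x))"
      using Suc by (intro Suc.IH) auto
  qed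
  then show ?case using Suc.prems differentiable_linear[OF assms(2)] by auto
qed

lemma C_on_bilinear:
  assumes "open S" "bounded_bilinear B"
  shows "C_on k S f \<Longrightarrow> C_on k S g \<Longrightarrow> C_on k S (\<lambda>x. B (f x) (g x))"
proof (induction k arbitrary: f g)
  case 0
  then show ?case by (auto intro: bounded_bilinear.continuous_on[OF assms(2)])
next
  case (Suc k)
  \<comment> \<open>The product rule leaves one factor undifferentiated, so both factors are also
    needed at level \<open>k\<close>.\<close>
  note fg = C_on_Suc_imp[OF Suc.prems(1)] C_on_Suc_imp[OF Suc.prems(2)]
  have "C_on k S (dd v (\<lambda>x. B (f x) (g x)))" for v
  proof (subst C_on_cong[OF assms(1)])
    show "dd v (\<lambda>x. B (f x) (g x)) x = B (f x) (dd v g x) + B (dd v f x) (g x)" if "x \<in> S" for x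
      using Suc.prems that assms by (intro dd_bilinear) auto
    show "C_on k S (\<lambda>x. B (f x) (dd v g x) + B (dd v f x) (g x))"
      using Suc fg assms by (intro C_on_add Suc.IH) auto
  qed
  moreover have "(\<lambda>x. B (f x) (g x)) differentiable at x" if "x \<in> S" for x
    using Suc.prems that by (intro differentiable_bilinear[OF assms(2)]) auto
  ultimately show ?case by simp
qed

lemma C_on_compose_linear:
  assumes "bounded_linear L" "open T"
  shows "open S \<Longrightarrow> L ` S \<subseteq> T \<Longrightarrow> C_on k T f \<Longrightarrow> C_on k S (\<lambda>x. f (L x))"
proof (induction k arbitrary: f)
  case 0
  then show ?case
    using continuous_on_compose2[of T f S L] linear_continuous_on[OF assms(1)] by auto
next
  case (Suc k)
  have d: "dd v (\<lambda>x. f (L x)) x = dd (L v) f (L x)" "(\<lambda>x. f (L x)) differentiable at x"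
    if "x \<in> S" for x v
    using Suc.prems that by (auto intro!: dd_compose_linear[OF assms(1)])
  have "C_on k S (dd v (\<lambda>x. f (L x)))" for v
  proof (subst C_on_cong[OF Suc.prems(1)])
    show "dd v (\<lambda>x. f (L x)) x = dd (L v) f (L x)" if "x \<in> S" for x
      using d(1)[OF that] .
    show "C_on k S (\<lambda>x. dd (L v) f (L x))"
      using Suc by (intro Suc.IH) auto
  qed
  then show ?case using d(2) by auto
qed

lemma smooth_on_cong:
  "open S \<Longrightarrow> (\<And>x. x \<in> S \<Longrightarrow> f x = g x) \<Longrightarrow> smooth_on S f \<longleftrightarrow> smooth_on S g"
  unfolding smooth_on_def using C_on_cong by blast

lemma smooth_on_subset: "smooth_on S f \<Longrightarrow> T \<subseteq> S \<Longrightarrow> smooth_on T f"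
  unfolding smooth_on_def using C_on_subset by blast

lemma smooth_on_const [simp]: "smooth_on S (\<lambda>x. a)"
  unfolding smooth_on_def using C_on_const by blast

lemma smooth_on_add:
  "open S \<Longrightarrow> smooth_on S f \<Longrightarrow> smooth_on S g \<Longrightarrow> smooth_on S (\<lambda>x. f x + g x)"
  unfolding smooth_on_def using C_on_add by blast

lemma smooth_on_linear:
  "open S \<Longrightarrow> bounded_linear L \<Longrightarrow> smooth_on S f \<Longrightarrow> smooth_on S (\<lambda>x. L (f x))"
  unfolding smooth_on_def using C_on_linear by blast

lemma smooth_on_bilinear:
  "open S \<Longrightarrow> bounded_bilinear B \<Longrightarrow> smooth_on S f \<Longrightarrow> smooth_on S g \<Longrightarrow> smooth_on S (\<lambda>x. B (f x) (g x))"
  unfolding smooth_on_def using C_on_bilinear by blast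

lemma smooth_on_compose_linear:
  "bounded_linear L \<Longrightarrow> open T \<Longrightarrow> open S \<Longrightarrow> L ` S \<subseteq> T \<Longrightarrow> smooth_on T f \<Longrightarrow> smooth_on S (\<lambda>x. f (L x))"
  unfolding smooth_on_def using C_on_compose_linear by blast

lemma smooth_on_dd: "smooth_on S f \<Longrightarrow> smooth_on S (dd v f)"
  unfolding smooth_on_def by (metis C_on.simps(2))

lemma smooth_on_differentiable: "smooth_on S f \<Longrightarrow> x \<in> S \<Longrightarrow> f differentiable at x"
  unfolding smooth_on_def by (metis C_on.simps(2))

lemma smooth_on_continuous: "smooth_on S f \<Longrightarrow> continuous_on S f"
  unfolding smooth_on_def by (metis C_on.simps(1))

lemma smooth_on_minus: "open S \<Longrightarrow> smooth_on S f \<Longrightarrow> smooth_on S (\<lambda>x. - f x)"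
  by (rule smooth_on_linear[OF _ bounded_linear_minus[OF bounded_linear_ident]])

lemma smooth_on_diff:
  "open S \<Longrightarrow> smooth_on S f \<Longrightarrow> smooth_on S g \<Longrightarrow> smooth_on S (\<lambda>x. f x - g x)"
  using smooth_on_add[of S f "\<lambda>x. - g x"] smooth_on_minus[of S g] by simp

lemma smooth_on_sum:
  assumes "open S"
  shows "(\<And>i. i \<in> A \<Longrightarrow> smooth_on S (f i)) \<Longrightarrow> smooth_on S (\<lambda>x. \<Sum>i\<in>A. f i x)"
  by (induction A rule: infinite_finite_induct) (auto intro: smooth_on_add assms)

lemmas smooth_on_scaleR = smooth_on_bilinear[OF _ bounded_bilinear_scaleR]
lemmas smooth_on_mult = smooth_on_bilinear[OF _ bounded_bilinear_mult]
lemmas smooth_on_inner = smooth_on_bilinear[OF _ bounded_bilinear_inner]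
lemmas smooth_on_apply = smooth_on_bilinear[OF _ bounded_bilinear_blinfun_apply]

text \<open>The mean value theorem is applied twice, along \<open>u\<close> and then along
  \<open>v\<close>. The second difference is symmetric in \<open>u\<close> and \<open>v\<close>, so
  reading the result with the two exchanged compares the mixed derivatives.\<close>

lemma second_difference:
  fixes f :: "'a::euclidean_space \<Rightarrow> real"
  assumes seg: "\<And>r t. 0 \<le> r \<Longrightarrow> r \<le> s \<Longrightarrow> 0 \<le> t \<Longrightarrow> t \<le> s \<Longrightarrow> x + r *\<^sub>R u + t *\<^sub>R v \<in> S"
    and "smooth_on S f" "s > 0"
  obtains r t where "0 \<le> r" "r \<le> s" "0 \<le> t" "t \<le> s"
    "f (x + s *\<^sub>R u + s *\<^sub>R v) - f (x + s *\<^sub>R u) - f (x + s *\<^sub>R v) + f x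
       = s\<^sup>2 * dd v (dd u f) (x + r *\<^sub>R u + t *\<^sub>R v)"
proof -
  have line: "((\<lambda>r. g (y + r *\<^sub>R w)) has_field_derivative dd w g (y + r *\<^sub>R w)) (at r)"
    if "smooth_on S g" "y + r *\<^sub>R w \<in> S" for g :: "'a \<Rightarrow> real" and y w r
  proof -
    have "(g has_derivative frechet_derivative g (at (y + r *\<^sub>R w))) (at (y + r *\<^sub>R w))"
      using smooth_on_differentiable[OF that] by (simp add: frechet_derivative_works)
    moreover have "((\<lambda>r. y + r *\<^sub>R w) has_derivative (\<lambda>h. h *\<^sub>R w)) (at r)"
      by (auto intro!: derivative_eq_intros)
    ultimately have "((\<lambda>r. g (y + r *\<^sub>R w)) has_derivative (\<lambda>h. dd (h *\<^sub>R w) g (y + r *\<^sub>R w))) (at r)"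
      by (rule has_derivative_compose[rotated])
    then show ?thesis
      using dd_direction_scale[OF smooth_on_differentiable[OF that]]
      by (simp add: has_field_derivative_def mult_commute_abs)
  qed
  \<comment> \<open>The increment of \<open>\<phi>\<close> over \<open>[0, s]\<close> is the second
    difference.\<close>
  define \<phi> where "\<phi> r = f (x + s *\<^sub>R v + r *\<^sub>R u) - f (x + r *\<^sub>R u)" for r
  have "\<exists>r. 0 < r \<and> r < s \<and> \<phi> s - \<phi> 0 = (s - 0) * (dd u f (x + s *\<^sub>R v + r *\<^sub>R u) - dd u f (x + r *\<^sub>R u))"
  proof (rule MVT2[OF \<open>s > 0\<close>])
    fix r :: real assume "0 \<le> r" "r \<le> s"
    then show "(\<phi> has_field_derivative (dd u f (x + s *\<^sub>R v + r *\<^sub>R u) - dd u f (x + r *\<^sub>R u))) (at r)"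
      unfolding \<phi>_def using seg[of r s] seg[of r 0] \<open>s > 0\<close>
      by (intro DERIV_diff line assms) (auto simp: algebra_simps)
  qed
  then obtain r where r: "0 < r" "r < s"
    "\<phi> s - \<phi> 0 = s * (dd u f (x + s *\<^sub>R v + r *\<^sub>R u) - dd u f (x + r *\<^sub>R u))" by auto
  have "\<exists>t. 0 < t \<and> t < s \<and> dd u f ((x + r *\<^sub>R u) + s *\<^sub>R v) - dd u f ((x + r *\<^sub>R u) + 0 *\<^sub>R v)
     = (s - 0) * dd v (dd u f) ((x + r *\<^sub>R u) + t *\<^sub>R v)"
    by (rule MVT2[OF \<open>s > 0\<close>], rule line) (use smooth_on_dd[OF assms(2)] seg r in auto)
  then obtain t where t: "0 < t" "t < s" "dd u f ((x + r *\<^sub>R u) + s *\<^sub>R v) - dd u f (x + r *\<^sub>R u)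
     = s * dd v (dd u f) ((x + r *\<^sub>R u) + t *\<^sub>R v)" by auto
  have "\<phi> s - \<phi> 0 = s * (s * dd v (dd u f) (x + r *\<^sub>R u + t *\<^sub>R v))"
    unfolding r(3) t(3)[symmetric] by (simp add: algebra_simps)
  then show ?thesis
    using that[of r t] r t unfolding \<phi>_def by (simp add: algebra_simps power2_eq_square)
qed

text \<open>Each mixed derivative, at some point of a small parallelogram, equals the same second
  difference divided by \<open>s\<^sup>2\<close>; continuity forces the values at \<open>x\<close>
  to agree.\<close>

lemma dd_commute_real:
  fixes f :: "'a::euclidean_space \<Rightarrow> real"
  assumes S: "open S" "x \<in> S" and f: "smooth_on S f"
  shows "dd u (dd v f) x = dd v (dd u f) x"
proof (rule ccontr)
  assume ne: "dd u (dd v f) x \<noteq> dd v (dd u f) x"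
  \<comment> \<open>Half the gap: a number cannot be within \<open>e\<close> of both sides.\<close>
  define e where "e = \<bar>dd u (dd v f) x - dd v (dd u f) x\<bar> / 2"
  have e: "e > 0" using ne by (simp add: e_def)
  have near: "\<exists>d>0. ball x d \<subseteq> S \<and> (\<forall>y\<in>ball x d. \<bar>dd a (dd b f) y - dd a (dd b f) x\<bar> < e)" for a b
  proof -
    have "continuous (at x) (dd a (dd b f))"
      using smooth_on_continuous[OF smooth_on_dd[OF smooth_on_dd[OF f]]] S
      by (simp add: continuous_on_eq_continuous_at)
    then obtain d where d: "d > 0" "\<forall>y. dist y x < d \<longrightarrow> dist (dd a (dd b f) y) (dd a (dd b f) x) < e"
      using e unfolding continuous_at_eps_delta by blast
    obtain d' where "d' > 0" "ball x d' \<subseteq> S" using S openE by blast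
    then show ?thesis
      using d by (intro exI[of _ "min d d'"]) (auto simp: dist_real_def dist_commute)
  qed
  obtain d1 where d1: "d1 > 0" "ball x d1 \<subseteq> S" "\<forall>y\<in>ball x d1. \<bar>dd u (dd v f) y - dd u (dd v f) x\<bar> < e"
    using near by blast
  obtain d2 where d2: "d2 > 0" "ball x d2 \<subseteq> S" "\<forall>y\<in>ball x d2. \<bar>dd v (dd u f) y - dd v (dd u f) x\<bar> < e"
    using near by blast
  \<comment> \<open>Keeps the parallelogram within half the smaller radius; the added 1 avoids a
    zero denominator when \<open>u = v = 0\<close>.\<close>
  define s where "s = min d1 d2 / (2 * (norm u + norm v + 1))"
  have pos: "norm u + norm v + 1 > 0" by (simp add: add_nonneg_pos)
  have s: "s > 0" using d1(1) d2(1) pos by (simp add: s_def)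
  have in_ball: "x + r *\<^sub>R u + t *\<^sub>R v \<in> ball x (min d1 d2)" if "0 \<le> r" "r \<le> s" "0 \<le> t" "t \<le> s" for r t
  proof -
    have "dist x (x + r *\<^sub>R u + t *\<^sub>R v) = norm (r *\<^sub>R u + t *\<^sub>R v)"
      using dist_add_cancel[of x 0 "r *\<^sub>R u + t *\<^sub>R v"] by (simp add: add.assoc)
    also have "\<dots> \<le> r * norm u + t * norm v"
      using norm_triangle_ineq[of "r *\<^sub>R u" "t *\<^sub>R v"] that by simp
    also have "\<dots> \<le> s * norm u + s * norm v"
      using that by (intro add_mono mult_right_mono) auto
    also have "\<dots> \<le> s * (norm u + norm v + 1)" using s by (simp add: algebra_simps)
    also have "\<dots> = min d1 d2 / 2"
    proof -
      have "a / (2 * b) * b = a / 2" if "b > 0" for a b :: real using that by simp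
      from this[OF pos] show ?thesis unfolding s_def .
    qed
    also have "\<dots> < min d1 d2" using d1(1) d2(1) by (simp add: min_def)
    finally show ?thesis by simp
  qed
  have in_ball': "x + t *\<^sub>R v + r *\<^sub>R u \<in> ball x (min d1 d2)" if "0 \<le> r" "r \<le> s" "0 \<le> t" "t \<le> s" for r t
    using in_ball[OF that] by (simp add: algebra_simps)
  have sub: "ball x (min d1 d2) \<subseteq> S" using d1(2) by auto
  obtain r t where rt: "0 \<le> r" "r \<le> s" "0 \<le> t" "t \<le> s"
    "f (x + s *\<^sub>R u + s *\<^sub>R v) - f (x + s *\<^sub>R u) - f (x + s *\<^sub>R v) + f x
       = s\<^sup>2 * dd v (dd u f) (x + r *\<^sub>R u + t *\<^sub>R v)"
    by (rule second_difference[of s x u v S f, OF subsetD[OF sub in_ball] f s]) blast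
  obtain r' t' where rt': "0 \<le> r'" "r' \<le> s" "0 \<le> t'" "t' \<le> s"
    "f (x + s *\<^sub>R v + s *\<^sub>R u) - f (x + s *\<^sub>R v) - f (x + s *\<^sub>R u) + f x
       = s\<^sup>2 * dd u (dd v f) (x + r' *\<^sub>R v + t' *\<^sub>R u)"
    by (rule second_difference[of s x v u S f, OF subsetD[OF sub in_ball'] f s]) blast
  have "dd v (dd u f) (x + r *\<^sub>R u + t *\<^sub>R v) = dd u (dd v f) (x + r' *\<^sub>R v + t' *\<^sub>R u)"
  proof -
    have "s\<^sup>2 * dd v (dd u f) (x + r *\<^sub>R u + t *\<^sub>R v) = s\<^sup>2 * dd u (dd v f) (x + r' *\<^sub>R v + t' *\<^sub>R u)"
      using rt(5) rt'(5) by (simp add: algebra_simps)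
    then show ?thesis using s by simp
  qed
  moreover have "\<bar>dd v (dd u f) (x + r *\<^sub>R u + t *\<^sub>R v) - dd v (dd u f) x\<bar> < e"
    using d2(3) in_ball[OF rt(1-4)] by auto
  moreover have "\<bar>dd u (dd v f) (x + r' *\<^sub>R v + t' *\<^sub>R u) - dd u (dd v f) x\<bar> < e"
    using d1(3) in_ball'[OF rt'(3,4,1,2)] by auto
  ultimately show False by (simp add: e_def abs_if split: if_splits)
qed

text \<open>Functionals reduce any normed target to the real case. For the operator fields
  \<open>G\<close> and \<open>\<Gamma>\<close> the functional is evaluation at fixed vectors
  followed by an inner product.\<close>

lemma dd_commute_functional:
  fixes f :: "'a::euclidean_space \<Rightarrow> 'b::real_normed_vector" and L :: "'b \<Rightarrow> real"
  assumes S: "open S" "x \<in> S" and f: "smooth_on S f" and L: "bounded_linear L"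
  shows "L (dd u (dd v f) x) = L (dd v (dd u f) x)"
proof -
  have *: "L (dd u (dd v f) x) = dd u (dd v (\<lambda>x. L (f x))) x" for u v
  proof -
    have "dd u (dd v (\<lambda>x. L (f x))) x = dd u (\<lambda>x. L (dd v f x)) x"
      by (rule dd_cong[OF S]) (rule dd_linear[OF L smooth_on_differentiable[OF f]])
    then show ?thesis
      by (simp add: dd_linear[OF L smooth_on_differentiable[OF smooth_on_dd[OF f] S(2)]])
  qed
  show ?thesis
    unfolding * using dd_commute_real[OF S smooth_on_linear[OF S(1) L f]] .
qed

lemma dd_commute:
  fixes f :: "'a::euclidean_space \<Rightarrow> 'b::euclidean_space"
  assumes "open S" "x \<in> S" "smooth_on S f"
  shows "dd u (dd v f) x = dd v (dd u f) x"
  by (rule euclidean_eqI) (rule dd_commute_functional[OF assms bounded_linear_inner_left])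

lemma dd_apply:
  "A differentiable at x \<Longrightarrow> w differentiable at x
    \<Longrightarrow> dd u (\<lambda>x. blinfun_apply (A x) (w x)) x = A x (dd u w x) + dd u A x (w x)"
  by (rule dd_bilinear[OF bounded_bilinear_blinfun_apply])

lemma dd_apply_const:
  "A differentiable at x \<Longrightarrow> dd u (\<lambda>x. blinfun_apply (A x) w) x = dd u A x w"
  by (rule dd_linear[OF blinfun.bounded_linear_left])

lemma dd_inner_const:
  "f differentiable at x \<Longrightarrow> dd u (\<lambda>x. f x \<bullet> w) x = dd u f x \<bullet> w"
  by (rule dd_linear[OF bounded_linear_inner_left])

lemma differentiable_apply:
  "A differentiable at x \<Longrightarrow> w differentiable at x \<Longrightarrow> (\<lambda>x. blinfun_apply (A x) (w x)) differentiable at x"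
  by (rule differentiable_bilinear[OF bounded_bilinear_blinfun_apply])

lemma differentiable_inner_at:
  "f differentiable at x \<Longrightarrow> g differentiable at x \<Longrightarrow> (\<lambda>x. f x \<bullet> g x) differentiable at x"
  by (rule differentiable_bilinear[OF bounded_bilinear_inner])


text \<open>As \<open>g\<close> vanishes at \<open>x\<close>, the term that would differentiate
  \<open>f\<close> disappears, so continuity of \<open>f\<close> suffices. This allows an inverse to
  be differentiated before it is known to be differentiable.\<close>

lemma has_derivative_bilinear_zero:
  fixes f :: "'a::real_normed_vector \<Rightarrow> 'b::real_normed_vector"
  assumes B: "bounded_bilinear B" and f: "isCont f x"
    and g: "(g has_derivative g') (at x)" "g x = 0"
  shows "((\<lambda>y. B (f y) (g y)) has_derivative (\<lambda>h. B (f x) (g' h))) (at x)"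
proof -
  obtain K where K: "\<And>a b. norm (B a b) \<le> norm a * norm b * K" "K > 0"
    using bounded_bilinear.pos_bounded[OF B] by blast
  obtain C where C: "\<And>h. norm (g' h) \<le> norm h * C" "C > 0"
    using bounded_linear.pos_bounded[OF has_derivative_bounded_linear[OF g(1)]] by blast
  let ?q = "\<lambda>y. norm (g y - g x - g' (y - x)) / norm (y - x)"
  have q: "?q \<midarrow>x\<rightarrow> 0"
    using g(1) by (simp add: has_derivative_iff_norm)
  have "(\<lambda>y. norm (f y) * ?q y * K + norm (f y - f x) * C * K) \<midarrow>x\<rightarrow> norm (f x) * 0 * K + norm (f x - f x) * C * K"
    by (intro tendsto_intros q isContD[OF f])
  then have lim: "(\<lambda>y. norm (f y) * ?q y * K + norm (f y - f x) * C * K) \<midarrow>x\<rightarrow> 0" by simp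
  have "norm (B (f y) (g y) - B (f x) (g x) - B (f x) (g' (y - x))) / norm (y - x)
      \<le> norm (f y) * ?q y * K + norm (f y - f x) * C * K" if "y \<noteq> x" for y
  proof -
    have "B (f y) (g y) - B (f x) (g x) - B (f x) (g' (y - x))
        = B (f y) (g y - g x - g' (y - x)) + B (f y - f x) (g' (y - x))"
      by (simp add: g(2) bounded_bilinear.diff_left[OF B] bounded_bilinear.diff_right[OF B]
          bounded_bilinear.zero_right[OF B])
    also have "norm \<dots> \<le> norm (f y) * norm (g y - g x - g' (y - x)) * K + norm (f y - f x) * norm (g' (y - x)) * K"
      by (rule norm_triangle_le, rule add_mono) (rule K(1))+
    also have "\<dots> \<le> norm (f y) * norm (g y - g x - g' (y - x)) * K + norm (f y - f x) * (norm (y - x) * C) * K"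
      using C K(2) by (intro add_mono mult_right_mono mult_left_mono) auto
    also have "\<dots> = norm (y - x) * (norm (f y) * ?q y * K + norm (f y - f x) * C * K)"
      using that by (simp add: field_simps)
    finally show ?thesis
      using that by (simp add: divide_le_eq mult.commute)
  qed
  then have "(\<lambda>y. norm (B (f y) (g y) - B (f x) (g x) - B (f x) (g' (y - x))) / norm (y - x)) \<midarrow>x\<rightarrow> 0"
    by (intro Lim_null_comparison[OF _ lim]) (simp add: eventually_at_filter always_eventually)
  then show ?thesis
    using has_derivative_bounded_linear[OF g(1)] bounded_bilinear.bounded_linear_right[OF B]
    by (auto simp: has_derivative_iff_norm intro: bounded_linear_compose)
qed

text \<open>The identity \<open>H y - H x = - H x (G y - G x) H y\<close> gives continuity once
  \<open>H y\<close> is bounded near \<open>x\<close>, and the same identity provides the bound by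
  absorption.\<close>

lemma isCont_blinfun_inverse:
  fixes G H :: "'a::real_normed_vector \<Rightarrow> 'e::real_normed_vector \<Rightarrow>\<^sub>L 'e"
  assumes S: "open S" "x \<in> S"
    and GH: "\<And>x. x \<in> S \<Longrightarrow> G x o\<^sub>L H x = id_blinfun" and HG: "\<And>x. x \<in> S \<Longrightarrow> H x o\<^sub>L G x = id_blinfun"
    and G: "isCont G x"
  shows "isCont H x"
proof -
  let ?K = "norm (H x) + 1"
  have K: "?K > 0" by (simp add: add_nonneg_pos)
  have lim0: "(\<lambda>y. norm (G y - G x)) \<midarrow>x\<rightarrow> 0"
    using G by (simp add: isCont_def LIM_zero tendsto_norm_zero)
  \<comment> \<open>Below this threshold \<open>norm (H x) * norm (G y - G x)\<close> is at most
    1/2, which bounds \<open>norm (H y)\<close> by twice \<open>?K\<close>.\<close>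
  have ev: "\<forall>\<^sub>F y in at x. norm (G y - G x) < 1 / (2 * ?K)"
    using order_tendstoD(2)[OF lim0, of "1 / (2 * ?K)"] K by simp
  have evS: "\<forall>\<^sub>F y in at x. y \<in> S" using S by (rule eventually_at_in_open')
  have "\<forall>\<^sub>F y in at x. norm (H y - H x) \<le> norm (G y - G x) * (2 * ?K * ?K)"
    using ev evS
  proof eventually_elim
    case (elim y)
    have "H y - H x = - (H x o\<^sub>L (G y - G x) o\<^sub>L H y)"
    proof (rule blinfun_eqI)
      fix w
      have "G y (H y w) = w" "H x (G x (H y w)) = H y w"
        using GH[OF elim(2)] HG[OF S(2)] by (metis blinfun_apply_blinfun_compose blinfun_apply_id_blinfun)+
      then show "(H y - H x) w = (- (H x o\<^sub>L (G y - G x) o\<^sub>L H y)) w"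
        by (simp add: blinfun.bilinear_simps)
    qed
    then have le: "norm (H y - H x) \<le> norm (H x) * norm (G y - G x) * norm (H y)"
      using norm_blinfun_compose[of "H x o\<^sub>L (G y - G x)" "H y"] norm_blinfun_compose[of "H x" "G y - G x"]
      by (smt (verit) mult_right_mono norm_ge_zero norm_minus_cancel)
    have "norm (H x) * norm (G y - G x) \<le> ?K * (1 / (2 * ?K))"
      using elim(1) by (intro mult_mono) auto
    also have "\<dots> = 1 / 2" using K by (simp add: field_simps)
    finally have "norm (H x) * norm (G y - G x) * norm (H y) \<le> 1 / 2 * norm (H y)"
      by (rule mult_right_mono) simp
    then have Hy: "norm (H y) \<le> 2 * ?K"
      using le norm_triangle_ineq2[of "H y" "H x"] by simp
    have "norm (H x) * norm (G y - G x) * norm (H y) \<le> ?K * norm (G y - G x) * (2 * ?K)"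
      using Hy K by (intro mult_mono) auto
    then show ?case using le by (simp add: mult_ac)
  qed
  then have "(\<lambda>y. H y - H x) \<midarrow>x\<rightarrow> 0"
    by (intro Lim_null_comparison[OF _ tendsto_mult_left_zero[OF lim0]])
  then show ?thesis by (simp add: isCont_def LIM_zero_iff)
qed

text \<open>The derivative \<open>- H (dG) H\<close> involves only \<open>H\<close> itself and the
  smooth \<open>dG\<close>, so each order of differentiability of \<open>H\<close> yields the
  next.\<close>

lemma smooth_on_blinfun_inverse:
  fixes G H :: "'a::euclidean_space \<Rightarrow> 'e::real_normed_vector \<Rightarrow>\<^sub>L 'e"
  assumes S: "open S"
    and GH: "\<And>x. x \<in> S \<Longrightarrow> G x o\<^sub>L H x = id_blinfun" and HG: "\<And>x. x \<in> S \<Longrightarrow> H x o\<^sub>L G x = id_blinfun"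
    and G: "smooth_on S G"
  shows "smooth_on S H"
proof -
  have cont: "isCont H x" if "x \<in> S" for x
    by (rule isCont_blinfun_inverse[OF S that GH HG])
       (use smooth_on_continuous[OF G] S that in \<open>auto simp: continuous_on_eq_continuous_at\<close>)
  have der: "(H has_derivative (\<lambda>h. - (H x o\<^sub>L (dd h G x o\<^sub>L H x)))) (at x)" if x: "x \<in> S" for x
  proof -
    have "(G has_derivative (\<lambda>h. dd h G x)) (at x)"
      using smooth_on_differentiable[OF G x] by (simp add: frechet_derivative_works)
    from bounded_linear.has_derivative[OF bounded_bilinear.bounded_linear_left
        [OF bounded_bilinear_blinfun_compose, of "H x"] has_derivative_diff[OF this has_derivative_const[of "G x"]]]
    have "((\<lambda>y. (G y - G x) o\<^sub>L H x) has_derivative (\<lambda>h. dd h G x o\<^sub>L H x)) (at x)" by simp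
    \<comment> \<open>The factor \<open>H y\<close>, so far only continuous, is harmless because
      \<open>G y - G x\<close> vanishes at \<open>y = x\<close>; subtracting the product from
      \<open>H x\<close> recovers \<open>H y\<close>.\<close>
    from has_derivative_bilinear_zero[OF bounded_bilinear_blinfun_compose cont[OF x] this]
    have "((\<lambda>y. H y o\<^sub>L ((G y - G x) o\<^sub>L H x)) has_derivative (\<lambda>h. H x o\<^sub>L (dd h G x o\<^sub>L H x))) (at x)"
      by (simp add: bounded_bilinear.zero_left[OF bounded_bilinear_blinfun_compose])
    from has_derivative_diff[OF has_derivative_const[of "H x"] this]
    have "((\<lambda>y. H x - (H y o\<^sub>L ((G y - G x) o\<^sub>L H x))) has_derivative (\<lambda>h. - (H x o\<^sub>L (dd h G x o\<^sub>L H x)))) (at x)"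
      by simp
    then show ?thesis
    proof (rule has_derivative_transform_within_open[OF _ S x])
      fix y assume y: "y \<in> S"
      show "H x - (H y o\<^sub>L ((G y - G x) o\<^sub>L H x)) = H y"
      proof (rule blinfun_eqI)
        fix w
        have "G x (H x w) = w" "H y (G y (H x w)) = H x w"
          using GH[OF x] HG[OF y] by (metis blinfun_apply_blinfun_compose blinfun_apply_id_blinfun)+
        then show "(H x - (H y o\<^sub>L ((G y - G x) o\<^sub>L H x))) w = H y w"
          by (simp add: blinfun.bilinear_simps)
      qed
    qed
  qed
  have "C_on k S H" for k
  proof (induction k)
    case 0
    show ?case using cont by (simp add: continuous_at_imp_continuous_on)
  next
    case (Suc k)
    have "C_on k S (dd v H)" for v
    proof (subst C_on_cong[OF S])
      show "dd v H x = - (H x o\<^sub>L (dd v G x o\<^sub>L H x))" if "x \<in> S" for x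
        using dd_eqI[OF der[OF that]] .
      have "C_on k S (dd v G)" using smooth_on_dd[OF G] by (simp add: smooth_on_def)
      then show "C_on k S (\<lambda>x. - (H x o\<^sub>L (dd v G x o\<^sub>L H x)))"
        by (intro C_on_linear[OF S bounded_linear_minus[OF bounded_linear_ident]]
            C_on_bilinear[OF S bounded_bilinear_blinfun_compose] Suc)
    qed
    then show ?case using der by (auto simp: differentiable_def)
  qed
  then show ?thesis by (simp add: smooth_on_def)
qed

text \<open>Linear extension from \<open>Basis\<close>: it turns coefficient families such as the
  Christoffel symbols into operator-valued functions.\<close>

definition blin :: "('a::euclidean_space \<Rightarrow> 'b::real_normed_vector) \<Rightarrow> 'a \<Rightarrow>\<^sub>L 'b" where
  "blin f = (\<Sum>i\<in>Basis. blinfun_scaleR_left (f i) o\<^sub>L blinfun_inner_left i)"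

lemma blin_apply: "blin f v = (\<Sum>i\<in>Basis. (v \<bullet> i) *\<^sub>R f i)"
  by (simp add: blin_def blinfun.sum_left)

lemma blin_Basis [simp]: "i \<in> Basis \<Longrightarrow> blin f i = f i"
  by (simp add: blin_apply inner_Basis if_distrib [of "\<lambda>r. r *\<^sub>R _"] if_distribR sum.delta cong: if_cong)

lemma smooth_on_blin:
  assumes "open S" "\<And>i. i \<in> Basis \<Longrightarrow> smooth_on S (\<lambda>x. f x i)"
  shows "smooth_on S (\<lambda>x. blin (f x))"
  unfolding blin_def
  by (intro smooth_on_sum assms smooth_on_bilinear[OF _ bounded_bilinear_blinfun_compose]
      smooth_on_linear[OF _ bounded_linear_blinfun_scaleR_left] smooth_on_const)

section \<open>Metrics in coordinates\<close>

locale coordinate_metric =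
  fixes S :: "'e::euclidean_space set" and g :: "'e \<Rightarrow> 'e \<Rightarrow> 'e \<Rightarrow> real"
  assumes S: "open S"
    and g_linear: "x \<in> S \<Longrightarrow> linear (\<lambda>u. g x u v)"
    and g_sym: "x \<in> S \<Longrightarrow> g x u v = g x v u"
    and g_pos: "x \<in> S \<Longrightarrow> v \<noteq> 0 \<Longrightarrow> g x v v > 0"
    and g_smooth: "i \<in> Basis \<Longrightarrow> j \<in> Basis \<Longrightarrow> smooth_on S (\<lambda>x. g x i j)"
begin

text \<open>\<open>G\<close> represents the metric with respect to the Euclidean inner product, \<open>H\<close> is its inverse, and
  \<open>\<Gamma> x u v\<close> is the covariant derivative of the constant field \<open>v\<close> along \<open>u\<close>.\<close>

definition G :: "'e \<Rightarrow> 'e \<Rightarrow>\<^sub>L 'e" where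
  "G x = blin (\<lambda>i. \<Sum>j\<in>Basis. g x i j *\<^sub>R j)"

definition H :: "'e \<Rightarrow> 'e \<Rightarrow>\<^sub>L 'e" where
  "H x = blin (\<lambda>i. \<Sum>j\<in>Basis. inv_metric g x i j *\<^sub>R j)"

definition \<Gamma> :: "'e \<Rightarrow> 'e \<Rightarrow>\<^sub>L 'e \<Rightarrow>\<^sub>L 'e" where
  "\<Gamma> x = blin (\<lambda>i. blin (\<lambda>j. \<Sum>k\<in>Basis. christoffel g k i j x *\<^sub>R k))"

lemma G_inner_Basis: "i \<in> Basis \<Longrightarrow> j \<in> Basis \<Longrightarrow> G x i \<bullet> j = g x i j"
  by (simp add: G_def)

lemma bilinear_g: "x \<in> S \<Longrightarrow> bilinear (g x)"
  using g_linear[of x] g_sym[of x] unfolding bilinear_def by (metis (no_types, lifting) ext)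

lemma bilinear_G_inner: "bilinear (\<lambda>u v. blinfun_apply A u \<bullet> v)"
  unfolding bilinear_def
  by (auto intro!: linearI simp: blinfun.bilinear_simps inner_add_left inner_add_right)

lemma G_inner: "x \<in> S \<Longrightarrow> G x u \<bullet> v = g x u v"
  using bilinear_eq_stdbasis[OF bilinear_G_inner bilinear_g, of x "G x"] G_inner_Basis by metis

lemma G_sym: "x \<in> S \<Longrightarrow> G x u \<bullet> v = G x v \<bullet> u"
  by (simp add: G_inner g_sym)

lemma G_pos: "x \<in> S \<Longrightarrow> v \<noteq> 0 \<Longrightarrow> G x v \<bullet> v > 0"
  by (simp add: G_inner g_pos)

lemma G_eq_iff: "x \<in> S \<Longrightarrow> G x u = G x v \<longleftrightarrow> u = v"
proof
  assume "x \<in> S" "G x u = G x v"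
  then have "G x (u - v) \<bullet> (u - v) = 0" by (simp add: blinfun.bilinear_simps)
  then show "u = v" using G_pos[OF \<open>x \<in> S\<close>, of "u - v"] by force
qed auto

lemma smooth_G: "smooth_on S G"
  unfolding G_def
  by (intro smooth_on_blin smooth_on_sum smooth_on_scaleR smooth_on_const S g_smooth)

text \<open>Positivity gives injectivity, and finite dimension does the rest.\<close>

lemma bij_G: "x \<in> S \<Longrightarrow> bij (blinfun_apply (G x))"
proof -
  assume x: "x \<in> S"
  have "linear (G x)" by (simp add: bounded_linear.linear blinfun.bounded_linear_right)
  moreover have "inj (G x)" using G_eq_iff[OF x] by (simp add: inj_def)
  ultimately show ?thesis using linear_injective_imp_surjective by (auto simp: bij_def)
qed

text \<open>The matrix in \<open>inv_metric\<close> contracts the second index of the metric,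
  \<open>G\<close> the first; symmetry identifies the two.\<close>

lemma inv_metric_eq: "x \<in> S \<Longrightarrow> inv_metric g x i j = inv (blinfun_apply (G x)) i \<bullet> j"
proof -
  assume x: "x \<in> S"
  have "(\<Sum>l\<in>Basis. g x k l * (v \<bullet> l)) = G x v \<bullet> k" if "k \<in> Basis" for k v
  proof -
    have "G x v \<bullet> k = G x k \<bullet> v" by (rule G_sym[OF x])
    also have "\<dots> = (\<Sum>l\<in>Basis. (G x k \<bullet> l) * (v \<bullet> l))" by (rule euclidean_inner)
    also have "\<dots> = (\<Sum>l\<in>Basis. g x k l * (v \<bullet> l))" by (simp add: G_inner[OF x])
    finally show ?thesis by simp
  qed
  then have "(\<lambda>v. \<Sum>k\<in>Basis. (\<Sum>l\<in>Basis. g x k l * (v \<bullet> l)) *\<^sub>R k) = blinfun_apply (G x)"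
    by (simp add: fun_eq_iff euclidean_representation)
  then show ?thesis by (simp add: inv_metric_def)
qed

lemma H_Basis: "x \<in> S \<Longrightarrow> i \<in> Basis \<Longrightarrow> H x i = inv (blinfun_apply (G x)) i"
  by (simp add: H_def inv_metric_eq euclidean_representation)

lemma GH [simp]: "x \<in> S \<Longrightarrow> G x (H x v) = v"
proof -
  assume x: "x \<in> S"
  have "G x o\<^sub>L H x = id_blinfun"
    by (rule blinfun_euclidean_eqI)
       (simp add: H_Basis x surj_f_inv_f[OF bij_is_surj[OF bij_G[OF x]]])
  then show ?thesis by (metis blinfun_apply_blinfun_compose blinfun_apply_id_blinfun)
qed

lemma HG [simp]: "x \<in> S \<Longrightarrow> H x (G x v) = v"
  using GH G_eq_iff by metis

lemma H_sym: "x \<in> S \<Longrightarrow> H x u \<bullet> v = H x v \<bullet> u"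
  using G_sym[of x "H x v" "H x u"] by (simp add: inner_commute)

lemma smooth_H: "smooth_on S H"
  by (rule smooth_on_blinfun_inverse[OF S _ _ smooth_G]) (auto intro!: blinfun_eqI)

lemma inv_metric_H: "x \<in> S \<Longrightarrow> i \<in> Basis \<Longrightarrow> inv_metric g x i j = H x i \<bullet> j"
  by (simp add: inv_metric_eq H_Basis)

lemma christoffel_eq: "i \<in> Basis \<Longrightarrow> j \<in> Basis \<Longrightarrow> k \<in> Basis \<Longrightarrow> christoffel g k i j x = \<Gamma> x i j \<bullet> k"
  by (simp add: \<Gamma>_def)

lemma smooth_inv_metric: "i \<in> Basis \<Longrightarrow> smooth_on S (\<lambda>x. inv_metric g x i j)"
  by (subst smooth_on_cong[OF S inv_metric_H])
     (auto intro!: smooth_on_inner smooth_on_apply smooth_H S smooth_on_const)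

lemma smooth_\<Gamma>: "smooth_on S \<Gamma>"
  unfolding \<Gamma>_def christoffel_def
  by (intro smooth_on_blin smooth_on_sum smooth_on_scaleR smooth_on_const S smooth_on_mult
      smooth_inv_metric smooth_on_add smooth_on_diff smooth_on_dd g_smooth)

lemmas diff_G [simp, intro] = smooth_on_differentiable[OF smooth_G]
lemmas diff_H [simp, intro] = smooth_on_differentiable[OF smooth_H]
lemmas diff_\<Gamma> [simp, intro] = smooth_on_differentiable[OF smooth_\<Gamma>]

lemma dd_G_sym:
  assumes x: "x \<in> S"
  shows "dd w G x u \<bullet> v = dd w G x v \<bullet> u"
proof -
  have *: "dd w G x u \<bullet> v = dd w (\<lambda>y. G y u \<bullet> v) x" for u v
    using x by (simp add: dd_inner_const dd_apply_const differentiable_apply)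
  show ?thesis unfolding * by (rule dd_cong[OF S x]) (rule G_sym)
qed

lemma dd_g_Basis:
  assumes x: "x \<in> S" and "i \<in> Basis" "j \<in> Basis"
  shows "dd w (\<lambda>y. g y i j) x = dd w G x i \<bullet> j"
proof -
  have "dd w (\<lambda>y. g y i j) x = dd w (\<lambda>y. G y i \<bullet> j) x"
    by (rule dd_cong[OF S x]) (simp add: G_inner)
  then show ?thesis
    using x by (simp add: dd_inner_const dd_apply_const differentiable_apply)
qed

text \<open>The Christoffel formula is the Koszul formula for constant fields, solved for
  \<open>\<Gamma>\<close> with the inverse metric; applying \<open>G\<close> undoes this.\<close>

lemma koszul:
  assumes x: "x \<in> S"
  shows "2 * (G x (\<Gamma> x u v) \<bullet> w) = dd u G x v \<bullet> w + dd v G x u \<bullet> w - dd w G x u \<bullet> v"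
proof -
  have basis: "2 * (G x (\<Gamma> x i j) \<bullet> k) = dd i G x j \<bullet> k + dd j G x i \<bullet> k - dd k G x i \<bullet> j"
    if "i \<in> Basis" "j \<in> Basis" "k \<in> Basis" for i j k
  proof -
    \<comment> \<open>Half the right-hand side, as a linear form in \<open>w\<close>, is the inner
      product with this vector; hence \<open>\<Gamma> x i j = H x K\<close>.\<close>
    define K where "K = (\<Sum>l\<in>Basis. ((1/2) * (dd i G x j \<bullet> l + dd j G x i \<bullet> l - dd l G x i \<bullet> j)) *\<^sub>R l)"
    have "\<Gamma> x i j \<bullet> m = H x K \<bullet> m" if "m \<in> Basis" for m
    proof -
      have "H x K \<bullet> m = K \<bullet> H x m" using H_sym[OF x, of K m] by (simp add: inner_commute)
      also have "\<dots> = (\<Sum>l\<in>Basis. ((1/2) * (dd i G x j \<bullet> l + dd j G x i \<bullet> l - dd l G x i \<bullet> j)) * (H x m \<bullet> l))"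
        by (simp add: K_def inner_sum_left inner_commute[of "H x m"])
      also have "\<dots> = christoffel g m i j x"
        using \<open>i \<in> Basis\<close> \<open>j \<in> Basis\<close> that x
        by (simp add: christoffel_def inv_metric_H dd_g_Basis sum_distrib_left algebra_simps)
      finally show ?thesis by (simp add: christoffel_eq \<open>i \<in> Basis\<close> \<open>j \<in> Basis\<close> that)
    qed
    then have "\<Gamma> x i j = H x K" by (rule euclidean_eqI)
    then have "G x (\<Gamma> x i j) \<bullet> k = K \<bullet> k" using x by simp
    then show ?thesis using \<open>k \<in> Basis\<close> by (simp add: K_def)
  qed
  have G_dir: "dd (a + b) G x = dd a G x + dd b G x" "dd (r *\<^sub>R a) G x = r *\<^sub>R dd a G x" for a b r
    using x by (simp_all add: dd_direction_add dd_direction_scale)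
  have "2 * (G x (\<Gamma> x u v) \<bullet> k) = dd u G x v \<bullet> k + dd v G x u \<bullet> k - dd k G x u \<bullet> v"
    if k: "k \<in> Basis" for k u v
  proof -
    have "bilinear (\<lambda>u v. 2 * (G x (\<Gamma> x u v) \<bullet> k))"
      unfolding bilinear_def
      by (auto intro!: linearI simp: blinfun.bilinear_simps inner_add_left distrib_left)
    moreover have "bilinear (\<lambda>u v. dd u G x v \<bullet> k + dd v G x u \<bullet> k - dd k G x u \<bullet> v)"
      unfolding bilinear_def
      by (auto intro!: linearI simp: G_dir blinfun.bilinear_simps inner_add_left inner_add_right algebra_simps)
    ultimately show ?thesis
      using bilinear_eq_stdbasis basis k by (metis (no_types, lifting))
  qed
  moreover have "linear (\<lambda>w. 2 * (G x (\<Gamma> x u v) \<bullet> w))"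
    by (auto intro!: linearI simp: inner_add_right distrib_left)
  moreover have "linear (\<lambda>w. dd u G x v \<bullet> w + dd v G x u \<bullet> w - dd w G x u \<bullet> v)"
    by (auto intro!: linearI simp: G_dir blinfun.bilinear_simps inner_add_left inner_add_right algebra_simps)
  ultimately show ?thesis
    using linear_eq_stdbasis by (metis (no_types, lifting))
qed

text \<open>Nondegeneracy makes the Koszul formula characterize \<open>\<Gamma>\<close>. A proposed
  connection can thus be verified without computing an inverse metric.\<close>

lemma \<Gamma>_eqI:
  assumes x: "x \<in> S"
    and "\<And>w. 2 * (G x z \<bullet> w) = dd u G x v \<bullet> w + dd v G x u \<bullet> w - dd w G x u \<bullet> v"
  shows "\<Gamma> x u v = z"
proof -
  have "G x (\<Gamma> x u v) \<bullet> w = G x z \<bullet> w" for w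
    using koszul[OF x, of u v w] assms(2)[of w] by simp
  then have "G x (\<Gamma> x u v) = G x z" by (metis vector_eq_rdot)
  then show ?thesis using G_eq_iff x by simp
qed

lemma \<Gamma>_sym: "x \<in> S \<Longrightarrow> \<Gamma> x u v = \<Gamma> x v u"
  by (rule \<Gamma>_eqI) (simp_all add: koszul dd_G_sym)

text \<open>Compatibility of connection and metric: in the sum of two Koszul formulas everything but
  the derivatives along \<open>w\<close> cancels.\<close>

lemma dd_G: "x \<in> S \<Longrightarrow> dd w G x u \<bullet> v = G x (\<Gamma> x w u) \<bullet> v + G x u \<bullet> \<Gamma> x w v"
  using koszul[of x w u v] koszul[of x w v u] G_sym[of x u "\<Gamma> x w v"] dd_G_sym[of x w u v]
    dd_G_sym[of x u w v] dd_G_sym[of x v w u] by simp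

end

lemma linear_expand:
  fixes A :: "'a::euclidean_space \<Rightarrow> 'b::real_vector"
  assumes "linear A"
  shows "A a = (\<Sum>k\<in>Basis. (a \<bullet> k) *\<^sub>R A k)"
  by (subst euclidean_representation[of a, symmetric])
     (simp only: linear_sum[OF assms] linear_cmul[OF assms])

lemma trace_commute:
  fixes A B :: "'e::euclidean_space \<Rightarrow> 'e"
  assumes "linear A" "linear B"
  shows "(\<Sum>i\<in>Basis. A (B i) \<bullet> i) = (\<Sum>i\<in>Basis. B (A i) \<bullet> i)"
proof -
  have *: "A (B i) \<bullet> i = (\<Sum>j\<in>Basis. (B i \<bullet> j) * (A j \<bullet> i))" if "linear A" for A B :: "'e \<Rightarrow> 'e" and i
    by (subst linear_expand[OF that]) (simp add: inner_sum_left)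
  show ?thesis
    unfolding *[OF assms(1), of B] *[OF assms(2), of A] by (subst sum.swap) (simp add: mult.commute)
qed

text \<open>Moves an endomorphism across a contraction at the price of a transpose; needed where the
  connection acts on an index of the inverse metric.\<close>

lemma trace_adjoint:
  fixes L :: "'e::euclidean_space \<Rightarrow> 'e" and B :: "'e \<Rightarrow> 'e \<Rightarrow> real"
  assumes L: "linear L" and B: "\<And>j. linear (\<lambda>i. B i j)" "\<And>i. linear (B i)"
  shows "(\<Sum>j\<in>Basis. B (L j) j) = (\<Sum>j\<in>Basis. B j (adjoint L j))"
proof -
  have "B (L j) j = (\<Sum>k\<in>Basis. (L j \<bullet> k) * B k j)" for j
    by (subst linear_expand[OF B(1)]) simp
  moreover have "B k (adjoint L k) = (\<Sum>j\<in>Basis. (L j \<bullet> k) * B k j)" for k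
    by (subst linear_expand[OF B(2)]) (simp add: adjoint_works[OF L] inner_commute[of "adjoint L k"])
  ultimately show ?thesis by (simp, subst sum.swap, simp)
qed

text \<open>A product rule for families not packaged as operators: expanding the argument in the
  basis, only derivatives at fixed arguments are required.\<close>

lemma dd_linear_family:
  fixes F :: "'a::euclidean_space \<Rightarrow> 'b::euclidean_space \<Rightarrow> 'c::real_normed_vector"
  assumes S: "open S" "x \<in> S" and F: "\<And>y. y \<in> S \<Longrightarrow> linear (F y)"
    and dF: "\<And>k. (\<lambda>y. F y k) differentiable at x" and w: "w differentiable at x"
  shows "dd u (\<lambda>y. F y (w y)) x = dd u (\<lambda>y. F y (w x)) x + F x (dd u w x)"
proof -
  have *: "dd u (\<lambda>y. F y (w y)) x
      = (\<Sum>k\<in>Basis. (w x \<bullet> k) *\<^sub>R dd u (\<lambda>y. F y k) x + (dd u w x \<bullet> k) *\<^sub>R F x k)"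
    if w: "w differentiable at x" for w
  proof -
    have "dd u (\<lambda>y. F y (w y)) x = dd u (\<lambda>y. \<Sum>k\<in>Basis. (w y \<bullet> k) *\<^sub>R F y k) x"
      by (rule dd_cong[OF S]) (rule linear_expand[OF F])
    also have "\<dots> = (\<Sum>k\<in>Basis. dd u (\<lambda>y. (w y \<bullet> k) *\<^sub>R F y k) x)"
      by (intro dd_sum differentiable_bilinear[OF bounded_bilinear_scaleR] differentiable_inner_at w dF) auto
    also have "\<dots> = (\<Sum>k\<in>Basis. (w x \<bullet> k) *\<^sub>R dd u (\<lambda>y. F y k) x + (dd u w x \<bullet> k) *\<^sub>R F x k)"
      using w dF by (simp add: dd_bilinear[OF bounded_bilinear_scaleR] differentiable_inner_at dd_inner_const)
    finally show ?thesis .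
  qed
  show ?thesis
    using *[OF w] *[of "\<lambda>_. w x"] linear_expand[OF F[OF S(2)], of "dd u w x"]
    by (simp add: sum.distrib)
qed

section \<open>The curvature tensor and the Bianchi identities\<close>

context coordinate_metric
begin

text \<open>Curvature evaluated on constant coordinate fields; these commute, so there is no bracket
  term.\<close>

definition Rm :: "'e \<Rightarrow> 'e \<Rightarrow> 'e \<Rightarrow> 'e \<Rightarrow> 'e" where
  "Rm x u v w = dd u \<Gamma> x v w - dd v \<Gamma> x u w + \<Gamma> x u (\<Gamma> x v w) - \<Gamma> x v (\<Gamma> x u w)"

text \<open>Contraction with the inverse metric amounts to inserting \<open>H x j\<close> in the
  last slot, which turns the scalar curvature into a double trace of \<open>Rm\<close>.\<close>

lemma coord_scalar_eq:
  assumes x: "x \<in> S"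
  shows "coord_scalar g x = (\<Sum>j\<in>Basis. \<Sum>i\<in>Basis. Rm x i j (H x j) \<bullet> i)"
proof -
  have \<Gamma>_Basis: "christoffel g k i j = (\<lambda>y. \<Gamma> y i j \<bullet> k)" if "i \<in> Basis" "j \<in> Basis" "k \<in> Basis" for i j k
    using christoffel_eq[OF that] by blast
  have dd\<Gamma>: "dd m (\<lambda>y. \<Gamma> y i j \<bullet> k) x = dd m \<Gamma> x i j \<bullet> k" for i j k m
    using x by (simp add: dd_inner_const dd_apply_const differentiable_apply)
  have expand: "(\<Sum>l\<in>Basis. (\<Gamma> x i l \<bullet> k) * (\<Gamma> x j m \<bullet> l)) = \<Gamma> x i (\<Gamma> x j m) \<bullet> k" for i j k m
    by (subst (3) linear_expand[OF bounded_linear.linear[OF blinfun.bounded_linear_right]])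
       (simp add: inner_sum_left mult.commute)
  have ricci: "coord_ricci g x j k = (\<Sum>i\<in>Basis. Rm x i j k \<bullet> i)" if "j \<in> Basis" "k \<in> Basis" for j k
    unfolding coord_ricci_def
  proof (rule sum.cong[OF refl])
    fix i :: 'e assume i: "i \<in> Basis"
    have "(\<Sum>l\<in>Basis. christoffel g i i l x * christoffel g l j k x - christoffel g i j l x * christoffel g l i k x)
      = \<Gamma> x i (\<Gamma> x j k) \<bullet> i - \<Gamma> x j (\<Gamma> x i k) \<bullet> i"
      using that i by (simp add: \<Gamma>_Basis expand[symmetric] sum_subtractf)
    then show "partial i (christoffel g i j k) x - partial j (christoffel g i i k) x +
      (\<Sum>l\<in>Basis. christoffel g i i l x * christoffel g l j k x - christoffel g i j l x * christoffel g l i k x)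
      = Rm x i j k \<bullet> i"
      using that i by (simp add: \<Gamma>_Basis dd\<Gamma> Rm_def inner_diff_left inner_add_left)
  qed
  have "(\<Sum>k\<in>Basis. inv_metric g x j k * coord_ricci g x j k) = (\<Sum>i\<in>Basis. Rm x i j (H x j) \<bullet> i)"
    if j: "j \<in> Basis" for j
  proof -
    have lin: "linear (\<lambda>w. Rm x i j w)" for i
      unfolding Rm_def by (auto intro!: linearI simp: blinfun.bilinear_simps algebra_simps)
    have "Rm x i j (H x j) \<bullet> i = (\<Sum>k\<in>Basis. (H x j \<bullet> k) * (Rm x i j k \<bullet> i))" for i
      by (subst linear_expand[OF lin]) (simp add: inner_sum_left)
    then have "(\<Sum>i\<in>Basis. Rm x i j (H x j) \<bullet> i) = (\<Sum>k\<in>Basis. \<Sum>i\<in>Basis. (H x j \<bullet> k) * (Rm x i j k \<bullet> i))"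
      by (simp, subst sum.swap, simp)
    then show ?thesis
      using j x by (simp add: ricci inv_metric_H sum_distrib_left)
  qed
  then show ?thesis by (simp add: coord_scalar_def)
qed

lemma Rm_swap: "Rm x v u w = - Rm x u v w"
  by (simp add: Rm_def)

text \<open>First Bianchi identity: the derivatives of \<open>\<Gamma>\<close> inherit its symmetry,
  and all terms cancel.\<close>

lemma Rm_cyclic:
  assumes x: "x \<in> S"
  shows "Rm x u v w + Rm x v w u + Rm x w u v = 0"
proof -
  have "dd a \<Gamma> x b d = dd a \<Gamma> x d b" for a b d
  proof -
    have *: "dd a \<Gamma> x b d = dd a (\<lambda>y. \<Gamma> y b d) x" for b d
      using x by (simp add: dd_apply_const differentiable_apply)
    show ?thesis unfolding * by (rule dd_cong[OF S x]) (rule \<Gamma>_sym)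
  qed
  from this[of u v w] this[of v u w] this[of w u v] show ?thesis
    by (simp add: Rm_def \<Gamma>_sym[OF x, of v u] \<Gamma>_sym[OF x, of w u] \<Gamma>_sym[OF x, of w v])
qed

text \<open>Second derivatives of \<open>G\<close> commute; expanded by metric compatibility, their
  difference consists of the two curvature terms.\<close>

lemma Rm_skew:
  assumes x: "x \<in> S"
  shows "G x (Rm x u v p) \<bullet> q = - (G x (Rm x u v q) \<bullet> p)"
proof -
  have second: "dd u (dd v G) x p \<bullet> q =
     G x (\<Gamma> x u (\<Gamma> x v p)) \<bullet> q + G x (\<Gamma> x v p) \<bullet> \<Gamma> x u q + G x (dd u \<Gamma> x v p) \<bullet> q
     + G x (\<Gamma> x u p) \<bullet> \<Gamma> x v q + G x p \<bullet> \<Gamma> x u (\<Gamma> x v q) + G x p \<bullet> dd u \<Gamma> x v q" for u v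
  proof -
    have "dd u (dd v G) x p \<bullet> q = dd u (\<lambda>y. dd v G y p \<bullet> q) x"
      using smooth_on_differentiable[OF smooth_on_dd[OF smooth_G] x]
      by (simp add: dd_inner_const dd_apply_const differentiable_apply)
    also have "\<dots> = dd u (\<lambda>y. G y (\<Gamma> y v p) \<bullet> q + G y p \<bullet> \<Gamma> y v q) x"
      by (rule dd_cong[OF S x]) (rule dd_G)
    also have "\<dots> = dd u G x (\<Gamma> x v p) \<bullet> q + G x (dd u \<Gamma> x v p) \<bullet> q + dd u G x p \<bullet> \<Gamma> x v q + G x p \<bullet> dd u \<Gamma> x v q"
      using x by (simp add: dd_add dd_bilinear[OF bounded_bilinear_inner] dd_apply differentiable_apply
          differentiable_inner_at inner_add_left blinfun.bilinear_simps)
    also have "\<dots> = G x (\<Gamma> x u (\<Gamma> x v p)) \<bullet> q + G x (\<Gamma> x v p) \<bullet> \<Gamma> x u q + G x (dd u \<Gamma> x v p) \<bullet> q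
     + G x (\<Gamma> x u p) \<bullet> \<Gamma> x v q + G x p \<bullet> \<Gamma> x u (\<Gamma> x v q) + G x p \<bullet> dd u \<Gamma> x v q"
      by (simp add: dd_G[OF x])
    finally show ?thesis .
  qed
  have "bounded_linear (\<lambda>A. blinfun_apply A p \<bullet> q)"
    by (intro bounded_linear_inner_left_comp blinfun.bounded_linear_left)
  from dd_commute_functional[OF S x smooth_G this, of u v] have
    "G x (Rm x u v p) \<bullet> q + G x p \<bullet> Rm x u v q = 0"
    unfolding second by (simp add: Rm_def blinfun.bilinear_simps inner_add_left inner_diff_left inner_add_right inner_diff_right)
  then show ?thesis using G_sym[OF x, of p] by simp
qed

lemma dd_Rm:
  assumes x: "x \<in> S"
  shows "dd w (\<lambda>y. Rm y u v z) x = dd w (dd u \<Gamma>) x v z - dd w (dd v \<Gamma>) x u z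
    + (dd w \<Gamma> x u (\<Gamma> x v z) + \<Gamma> x u (dd w \<Gamma> x v z)) - (dd w \<Gamma> x v (\<Gamma> x u z) + \<Gamma> x v (dd w \<Gamma> x u z))"
  unfolding Rm_def using x smooth_on_differentiable[OF smooth_on_dd[OF smooth_\<Gamma>] x]
  by (simp add: dd_add dd_diff dd_apply dd_apply_const differentiable_apply blinfun.bilinear_simps)

lemma smooth_Rm: "smooth_on S (\<lambda>y. Rm y u v z)"
  unfolding Rm_def
  by (intro smooth_on_add smooth_on_diff smooth_on_apply smooth_\<Gamma> smooth_on_dd S smooth_on_const)

text \<open>The connection corrections in the slots \<open>u\<close>, \<open>v\<close>,
  \<open>w\<close> are left out because they cancel in the cyclic sum by symmetry of
  \<open>\<Gamma>\<close>. What remains follows from commuting the second derivatives of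
  \<open>\<Gamma>\<close>.\<close>

lemma second_bianchi:
  assumes x: "x \<in> S"
  shows "(dd w (\<lambda>y. Rm y u v z) x + \<Gamma> x w (Rm x u v z) - Rm x u v (\<Gamma> x w z))
    + (dd u (\<lambda>y. Rm y v w z) x + \<Gamma> x u (Rm x v w z) - Rm x v w (\<Gamma> x u z))
    + (dd v (\<lambda>y. Rm y w u z) x + \<Gamma> x v (Rm x w u z) - Rm x w u (\<Gamma> x v z)) = 0"
proof -
  have comm: "dd a (dd b \<Gamma>) x p z = dd b (dd a \<Gamma>) x p z" for a b p
  proof (rule euclidean_eqI)
    fix i :: 'e
    have "bounded_linear (\<lambda>A. blinfun_apply (blinfun_apply A p) z \<bullet> i)"
      by (intro bounded_linear_inner_left_comp bounded_linear_compose[OF blinfun.bounded_linear_left]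
          blinfun.bounded_linear_left)
    from dd_commute_functional[OF S x smooth_\<Gamma> this]
    show "dd a (dd b \<Gamma>) x p z \<bullet> i = dd b (dd a \<Gamma>) x p z \<bullet> i" .
  qed
  show ?thesis
    unfolding dd_Rm[OF x] comm[of u w] comm[of v u] comm[of w v] unfolding Rm_def
    by (simp add: blinfun.bilinear_simps algebra_simps)
qed

end

section \<open>Solutions of \<open>Hess h = \<sigma> g\<close>\<close>

text \<open>Serves both \<open>h\<close> on the product and \<open>f\<close> on the base, where the
  factor is \<open>c f\<close>. Smoothness of \<open>\<sigma>\<close> is a consequence, proved in
  \<open>smooth_\<sigma>\<close>.\<close>

locale conformal_hessian = coordinate_metric +
  fixes h \<sigma> :: "'a \<Rightarrow> real"
  assumes h_smooth: "smooth_on S h"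
    and hessian: "x \<in> S \<Longrightarrow> dd u (dd v h) x - dd (\<Gamma> x u v) h x = \<sigma> x * (G x u \<bullet> v)"
begin

text \<open>The gradient: \<open>H\<close> raises the index of the differential of
  \<open>h\<close>.\<close>

definition V :: "'a \<Rightarrow> 'a" where
  "V x = H x (\<Sum>i\<in>Basis. dd i h x *\<^sub>R i)"

lemma diff_h [simp, intro]: "x \<in> S \<Longrightarrow> h differentiable at x"
  using smooth_on_differentiable[OF h_smooth] .

lemma diff_dd_h [simp, intro]: "x \<in> S \<Longrightarrow> dd u h differentiable at x"
  using smooth_on_differentiable[OF smooth_on_dd[OF h_smooth]] .

lemma G_V: "x \<in> S \<Longrightarrow> G x (V x) \<bullet> w = dd w h x"
  using linear_expand[OF linear_frechet_derivative[OF diff_h], of x w]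
  by (simp add: V_def inner_sum_left inner_commute[of w] mult.commute)

lemma smooth_V: "smooth_on S V"
  unfolding V_def
  by (intro smooth_on_apply smooth_H S smooth_on_sum smooth_on_scaleR smooth_on_dd h_smooth smooth_on_const)

lemmas diff_V [simp, intro] = smooth_on_differentiable[OF smooth_V]

text \<open>The Hessian equation with one index raised: the covariant derivative of \<open>V\<close>
  is \<open>\<sigma>\<close> times the identity.\<close>

lemma dd_V:
  assumes x: "x \<in> S"
  shows "dd u V x = \<sigma> x *\<^sub>R u - \<Gamma> x u (V x)"
proof -
  have "G x (dd u V x) \<bullet> w = G x (\<sigma> x *\<^sub>R u - \<Gamma> x u (V x)) \<bullet> w" for w
  proof -
    have "dd u G x (V x) \<bullet> w + G x (dd u V x) \<bullet> w = dd u (\<lambda>y. G y (V y) \<bullet> w) x"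
      using x by (simp add: dd_inner_const dd_apply differentiable_apply inner_add_left)
    also have "\<dots> = dd u (dd w h) x"
      by (rule dd_cong[OF S x]) (rule G_V)
    also have "\<dots> = \<sigma> x * (G x u \<bullet> w) + G x (V x) \<bullet> \<Gamma> x u w"
      using hessian[OF x, where u = u and v = w] G_V[OF x] by simp
    finally show ?thesis
      by (simp add: dd_G[OF x] blinfun.bilinear_simps inner_diff_left)
  qed
  then show ?thesis using G_eq_iff[OF x] by (metis vector_eq_rdot)
qed

text \<open>One diagonal component of the covariant derivative of the smooth field \<open>V\<close>
  already determines \<open>\<sigma>\<close>.\<close>

lemma smooth_\<sigma>: "smooth_on S \<sigma>"
proof -
  obtain b :: 'a where b: "b \<in> Basis" using nonempty_Basis by blast
  have "\<sigma> x = (dd b V x + \<Gamma> x b (V x)) \<bullet> b" if "x \<in> S" for x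
    using dd_V[OF that] b by simp
  moreover have "smooth_on S (\<lambda>x. (dd b V x + \<Gamma> x b (V x)) \<bullet> b)"
    by (intro smooth_on_inner smooth_on_add smooth_on_dd smooth_V smooth_on_apply smooth_\<Gamma> S smooth_on_const)
  ultimately show ?thesis by (subst smooth_on_cong[OF S])
qed

lemmas diff_\<sigma> [simp, intro] = smooth_on_differentiable[OF smooth_\<sigma>]

lemma dd_norm_V:
  assumes x: "x \<in> S"
  shows "dd u (\<lambda>y. G y (V y) \<bullet> V y) x = 2 * \<sigma> x * dd u h x"
proof -
  have "dd u (\<lambda>y. G y (V y) \<bullet> V y) x
      = dd u G x (V x) \<bullet> V x + G x (dd u V x) \<bullet> V x + G x (V x) \<bullet> dd u V x"
    using x by (simp add: dd_bilinear[OF bounded_bilinear_inner] dd_apply differentiable_apply inner_add_left)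
  also have "\<dots> = 2 * \<sigma> x * (G x (V x) \<bullet> u)"
    using G_sym[OF x, of u "V x"] G_sym[OF x, of "\<Gamma> x u (V x)" "V x"]
    by (simp add: dd_V[OF x] dd_G[OF x] blinfun.bilinear_simps inner_diff_left inner_diff_right)
  finally show ?thesis by (simp add: G_V[OF x])
qed

text \<open>The Ricci identity for \<open>V\<close>: antisymmetrizing its second covariant
  derivatives leaves only derivatives of \<open>\<sigma>\<close>.\<close>

lemma Rm_V:
  assumes x: "x \<in> S"
  shows "Rm x u v (V x) = dd u \<sigma> x *\<^sub>R v - dd v \<sigma> x *\<^sub>R u"
proof -
  have second: "dd u (dd v V) x = dd u \<sigma> x *\<^sub>R v - dd u \<Gamma> x v (V x) - \<Gamma> x v (\<sigma> x *\<^sub>R u - \<Gamma> x u (V x))" for u v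
  proof -
    have "dd u (dd v V) x = dd u (\<lambda>y. \<sigma> y *\<^sub>R v - \<Gamma> y v (V y)) x"
      by (rule dd_cong[OF S x]) (rule dd_V)
    also have "\<dots> = dd u (\<lambda>y. \<sigma> y *\<^sub>R v) x - dd u (\<lambda>y. \<Gamma> y v (V y)) x"
      using x by (intro dd_diff differentiable_apply) auto
    also have "dd u (\<lambda>y. \<sigma> y *\<^sub>R v) x = dd u \<sigma> x *\<^sub>R v"
      using x by (intro dd_linear bounded_linear_scaleR_left) auto
    finally show ?thesis
      using x by (simp add: dd_apply dd_apply_const differentiable_apply dd_V algebra_simps)
  qed
  from dd_commute[OF S x smooth_V, of u v] show ?thesis
    unfolding second Rm_def using \<Gamma>_sym[OF x, of u v]
    by (simp add: blinfun.bilinear_simps algebra_simps)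
qed

end

text \<open>Components on the basis suffice, since both sides are bilinear in the
  directions.\<close>

lemma (in coordinate_metric) conformal_hessianI:
  assumes F: "smooth_on S F"
    and hess: "\<And>x i j. x \<in> S \<Longrightarrow> i \<in> Basis \<Longrightarrow> j \<in> Basis \<Longrightarrow> coord_hessian g F x i j = \<tau> x * g x i j"
  shows "conformal_hessian S g F \<tau>"
proof unfold_locales
  show "smooth_on S F" by (rule F)
  fix x u v assume x: "x \<in> S"
  note dF = smooth_on_differentiable[OF F x] smooth_on_differentiable[OF smooth_on_dd[OF F] x]
  have dir: "dd (a + b) F x = dd a F x + dd b F x" "dd (r *\<^sub>R a) F x = r *\<^sub>R dd a F x" for a b r
    using dF by (simp_all add: dd_direction_add dd_direction_scale)
  have dir2: "dd (a + b) (dd d F) x = dd a (dd d F) x + dd b (dd d F) x"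
    "dd (r *\<^sub>R a) (dd d F) x = r *\<^sub>R dd a (dd d F) x" for a b d r
    using dF by (simp_all add: dd_direction_add dd_direction_scale)
  \<comment> \<open>Linearity in the inner direction is reduced to that in the outer one by
    commuting the derivatives.\<close>
  have dir3: "dd d (dd (a + b) F) x = dd d (dd a F) x + dd d (dd b F) x"
    "dd d (dd (r *\<^sub>R a) F) x = r *\<^sub>R dd d (dd a F) x" for a b d r
    unfolding dd_commute[OF S x F, where u = d and v = "a + b"] dd_commute[OF S x F, where u = d and v = "r *\<^sub>R a"]
      dd_commute[OF S x F, where u = d and v = a] dd_commute[OF S x F, where u = d and v = b] by (simp_all only: dir2)
  have "bilinear (\<lambda>u v. dd u (dd v F) x - dd (\<Gamma> x u v) F x)"
    unfolding bilinear_def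
    by (auto intro!: linearI simp: dir dir2 dir3 blinfun.bilinear_simps algebra_simps)
  moreover have "bilinear (\<lambda>u v. \<tau> x * (G x u \<bullet> v))"
    unfolding bilinear_def
    by (auto intro!: linearI simp: blinfun.bilinear_simps inner_add_left inner_add_right algebra_simps)
  moreover have "dd i (dd j F) x - dd (\<Gamma> x i j) F x = \<tau> x * (G x i \<bullet> j)"
    if "i \<in> Basis" "j \<in> Basis" for i j
  proof -
    have "dd (\<Gamma> x i j) F x = (\<Sum>k\<in>Basis. christoffel g k i j x * partial k F x)"
      using linear_expand[OF linear_frechet_derivative[OF dF(1)], of "\<Gamma> x i j"] that
      by (simp add: christoffel_eq)
    then show ?thesis
      using hess[OF x that] by (simp add: coord_hessian_def G_inner[OF x])
  qed
  ultimately show "dd u (dd v F) x - dd (\<Gamma> x u v) F x = \<tau> x * (G x u \<bullet> v)"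
    using bilinear_eq_stdbasis by (metis (no_types, lifting))
qed

section \<open>Deviation from constant curvature along the gradient\<close>

locale concircular = conformal_hessian +
  fixes c :: real
  assumes d\<sigma>: "x \<in> S \<Longrightarrow> dd u \<sigma> x = c * dd u h x"
begin

text \<open>\<open>K\<close> is the deviation of the curvature tensor from constant curvature \<open>- c\<close>.\<close>

definition K :: "'a \<Rightarrow> 'a \<Rightarrow> 'a \<Rightarrow> 'a \<Rightarrow> 'a" where
  "K x u v w = Rm x u v w + c *\<^sub>R ((G x v \<bullet> w) *\<^sub>R u - (G x u \<bullet> w) *\<^sub>R v)"

lemma K_swap: "K x v u w = - K x u v w"
  by (simp add: K_def Rm_swap[of x v u] algebra_simps)

lemma K_cyclic: "x \<in> S \<Longrightarrow> K x u v w + K x v w u + K x w u v = 0"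
  using Rm_cyclic[of x u v w] G_sym[of x u v] G_sym[of x u w] G_sym[of x v w]
  by (simp add: K_def algebra_simps)

lemma K_skew: "x \<in> S \<Longrightarrow> G x (K x u v p) \<bullet> q = - (G x (K x u v q) \<bullet> p)"
  using Rm_skew[of x u v p q] G_sym[of x u v]
  by (simp add: K_def blinfun.bilinear_simps inner_add_left inner_diff_left algebra_simps)

text \<open>The classical octahedron argument: four instances of the cyclic identity combined with
  the two skew symmetries.\<close>

lemma K_pair:
  assumes x: "x \<in> S"
  shows "G x (K x u v p) \<bullet> q = G x (K x p q u) \<bullet> v"
proof -
  have cyc: "G x (K x u v w) \<bullet> z + G x (K x v w u) \<bullet> z + G x (K x w u v) \<bullet> z = 0" for u v w z
    using arg_cong[OF K_cyclic[OF x, of u v w], of "\<lambda>a. G x a \<bullet> z"]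
    by (simp add: blinfun.bilinear_simps inner_add_left)
  have swap: "G x (K x u v w) \<bullet> z = - (G x (K x v u w) \<bullet> z)" for u v w z
    by (subst K_swap) (simp add: blinfun.bilinear_simps)
  note skew = K_skew[OF x]
  show ?thesis
    using cyc[of u v p q] cyc[of v p q u] cyc[of p q u v] cyc[of q u v p]
      skew[of u v p q] skew[of v p u q] skew[of p u v q] skew[of v p q u] skew[of p q v u]
      skew[of q v p u] skew[of p q u v] skew[of q u p v] skew[of u p q v] skew[of q u v p] skew[of u v q p]
      skew[of v q u p]
      swap[of u v p q] swap[of v p u q] swap[of p u v q] swap[of p q u v] swap[of q u p v] swap[of v q p u]
      swap[of u p q v] swap[of u v q p] swap[of p q v u] swap[of q v u p] swap[of q u v p]
    by linarith
qed

lemma K_V_right: "x \<in> S \<Longrightarrow> K x u v (V x) = 0"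
  using G_sym[of x u "V x"] G_sym[of x v "V x"]
  by (simp add: K_def Rm_V d\<sigma> G_V algebra_simps)

text \<open>Pair symmetry followed by skew symmetry carries \<open>V\<close> to the third slot,
  where \<open>K_V_right\<close> applies.\<close>

lemma K_V_left: "x \<in> S \<Longrightarrow> K x v (V x) w = 0"
proof -
  assume x: "x \<in> S"
  have "G x (K x v (V x) w) \<bullet> z = 0" for z
    using K_pair[OF x, of v "V x" w z] K_pair[OF x, of w z v "V x"] K_skew[OF x, of w z v "V x"] x
    by (simp add: K_V_right)
  then have "G x (K x v (V x) w) = G x 0" by (metis blinfun.zero_right inner_eq_zero_iff)
  then show ?thesis using G_eq_iff[OF x] by blast
qed


lemma linear_K:
  assumes x: "x \<in> S"
  shows "linear (\<lambda>u. K x u v w)" "linear (\<lambda>v. K x u v w)" "linear (K x u v)"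
proof -
  have dir: "dd (a + b) \<Gamma> x = dd a \<Gamma> x + dd b \<Gamma> x" "dd (r *\<^sub>R a) \<Gamma> x = r *\<^sub>R dd a \<Gamma> x" for a b r
    using x by (simp_all add: dd_direction_add dd_direction_scale)
  show "linear (\<lambda>u. K x u v w)" "linear (\<lambda>v. K x u v w)" "linear (K x u v)"
    by (rule linearI; simp add: K_def Rm_def dir blinfun.bilinear_simps inner_add_left inner_add_right algebra_simps)+
qed

lemma smooth_K: "smooth_on S (\<lambda>y. K y u v z)"
  unfolding K_def
  by (intro smooth_on_add smooth_on_diff smooth_on_scaleR smooth_on_inner smooth_on_apply
      smooth_Rm smooth_G S smooth_on_const)

lemmas diff_K [simp, intro] = smooth_on_differentiable[OF smooth_K]

text \<open>The constant curvature part is built from the metric alone, hence parallel, and drops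
  out of the second Bianchi identity.\<close>

lemma K_bianchi:
  assumes x: "x \<in> S"
  shows "(dd w (\<lambda>y. K y u v z) x + \<Gamma> x w (K x u v z) - K x u v (\<Gamma> x w z))
    + (dd u (\<lambda>y. K y v w z) x + \<Gamma> x u (K x v w z) - K x v w (\<Gamma> x u z))
    + (dd v (\<lambda>y. K y w u z) x + \<Gamma> x v (K x w u z) - K x w u (\<Gamma> x v z)) = 0"
proof -
  have dK: "dd w (\<lambda>y. K y u v z) x = dd w (\<lambda>y. Rm y u v z) x
      + c *\<^sub>R ((dd w G x v \<bullet> z) *\<^sub>R u - (dd w G x u \<bullet> z) *\<^sub>R v)" for u v w
  proof -
    have d: "(\<lambda>y. (G y a \<bullet> z) *\<^sub>R b) differentiable at x"
      "dd w (\<lambda>y. (G y a \<bullet> z) *\<^sub>R b) x = (dd w G x a \<bullet> z) *\<^sub>R b" for a b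
      using x by (auto intro!: differentiable_linear[OF bounded_linear_scaleR_left]
          simp: dd_linear[OF bounded_linear_scaleR_left] dd_inner_const dd_apply_const
            differentiable_apply differentiable_inner_at)
    have d': "(\<lambda>y. (G y v \<bullet> z) *\<^sub>R u - (G y u \<bullet> z) *\<^sub>R v) differentiable at x"
      by (intro differentiable_diff d)
    show ?thesis
      unfolding K_def
      by (subst dd_add, rule smooth_on_differentiable[OF smooth_Rm x],
          rule differentiable_linear[OF bounded_linear_scaleR_right d'])
         (simp add: dd_linear[OF bounded_linear_scaleR_right d'] dd_diff d)
  qed
  show ?thesis
    unfolding dK
    using second_bianchi[OF x, where w = w and u = u and v = v and z = z] \<Gamma>_sym[OF x, of u w] \<Gamma>_sym[OF x, of v w] \<Gamma>_sym[OF x, of u v]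
    by (simp add: K_def dd_G[OF x] blinfun.bilinear_simps algebra_simps)
qed

text \<open>Covariantly this is \<open>- 2 \<sigma> K\<close> for the derivative of \<open>K\<close>
  along \<open>V\<close>; the \<open>\<Gamma>\<close> terms are the corrections for the value and
  the three arguments.\<close>

lemma dd_V_K:
  assumes x: "x \<in> S"
  shows "dd (V x) (\<lambda>y. K y u v z) x = - (2 * \<sigma> x) *\<^sub>R K x u v z - \<Gamma> x (V x) (K x u v z)
    + K x u v (\<Gamma> x (V x) z) + K x (\<Gamma> x (V x) u) v z + K x u (\<Gamma> x (V x) v) z"
proof -
  \<comment> \<open>Differentiating \<open>K y v (V y) z = 0\<close> trades the derivative of
    \<open>K\<close> for that of \<open>V\<close>, the source of the factor
    \<open>\<sigma>\<close>.\<close>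
  have dV: "dd u (\<lambda>y. K y v (V x) z) x = - \<sigma> x *\<^sub>R K x v u z + K x v (\<Gamma> x (V x) u) z" for u v
  proof -
    have "0 = dd u (\<lambda>y. K y v (V y) z) x"
      by (subst dd_cong[OF S x, of _ "\<lambda>_. 0"]) (simp_all add: K_V_left)
    also have "\<dots> = dd u (\<lambda>y. K y v (V x) z) x + K x v (dd u V x) z"
      using x by (intro dd_linear_family[OF S x, of "\<lambda>y k. K y v k z"] linear_K) auto
    finally show ?thesis
      using \<Gamma>_sym[OF x, of u "V x"]
      by (simp add: dd_V[OF x] linear_diff[OF linear_K(2)[OF x]] linear_cmul[OF linear_K(2)[OF x]]
          add_eq_0_iff eq_neg_iff_add_eq_0 algebra_simps)
  qed
  have "dd v (\<lambda>y. K y (V x) u z) x = - dd v (\<lambda>y. K y u (V x) z) x"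
    using dd_linear[OF bounded_linear_minus[OF bounded_linear_ident] diff_K[OF x, of u "V x" z]]
    by (simp add: K_swap[of _ "V x" u])
  then have dV': "dd v (\<lambda>y. K y (V x) u z) x = \<sigma> x *\<^sub>R K x u v z - K x u (\<Gamma> x (V x) v) z"
    by (simp add: dV)
  have two: "(\<sigma> x * 2) *\<^sub>R a = \<sigma> x *\<^sub>R a + \<sigma> x *\<^sub>R a" for a :: 'a
    by (simp add: scaleR_left_distrib[symmetric])
  show ?thesis
    using K_bianchi[OF x, where w = "V x" and u = u and v = v and z = z] K_swap[of x u v z] K_swap[of x v "\<Gamma> x (V x) u" z]
    by (simp add: two dV dV' K_V_left[OF x] K_swap[of x "V x" u] blinfun.bilinear_simps algebra_simps)
qed

text \<open>The inverse metric is parallel, as differentiating \<open>G H = id\<close> shows. The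
  transpose accounts for the second upper index of \<open>H\<close>, which meets \<open>j\<close>
  through the Euclidean product.\<close>

lemma dd_H:
  assumes x: "x \<in> S"
  shows "dd w H x j = - \<Gamma> x w (H x j) - H x (adjoint (\<Gamma> x w) j)"
proof -
  have lin: "linear (\<Gamma> x w)" by (simp add: blinfun.bounded_linear_right bounded_linear.linear)
  have "dd w (\<lambda>y. G y (H y j)) x = 0"
    by (subst dd_cong[OF S x, of _ "\<lambda>_. j"]) simp_all
  then have "dd w G x (H x j) + G x (dd w H x j) = 0"
    using x by (simp add: dd_apply dd_apply_const differentiable_apply add.commute)
  then have *: "dd w G x (H x j) \<bullet> z + G x (dd w H x j) \<bullet> z = 0" for z
    by (metis inner_add_left inner_zero_left)
  then have "G x (dd w H x j) \<bullet> z = G x (- \<Gamma> x w (H x j) - H x (adjoint (\<Gamma> x w) j)) \<bullet> z" for z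
    using dd_G[OF x, of w "H x j" z] x adjoint_works[OF lin, of z j] *[of z]
    by (simp add: blinfun.bilinear_simps inner_diff_right inner_commute)
  then show ?thesis using G_eq_iff[OF x] by (metis vector_eq_rdot)
qed

definition s :: "'a \<Rightarrow> real" where
  "s x = (\<Sum>j\<in>Basis. \<Sum>i\<in>Basis. K x i j (H x j) \<bullet> i)"

text \<open>In the trace of the constant curvature part \<open>H\<close> cancels \<open>G\<close>,
  and what is left counts the pairs of distinct basis vectors.\<close>

lemma s_eq: "x \<in> S \<Longrightarrow> s x = coord_scalar g x + c * (real DIM('a) * real DIM('a) - real DIM('a))"
proof -
  assume x: "x \<in> S"
  have 1: "G x j \<bullet> H x j = 1" if "j \<in> Basis" for j
    using G_sym[OF x, of j "H x j"] x that by simp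
  have 2: "G x i \<bullet> H x j = j \<bullet> i" for i j
    using G_sym[OF x, of i "H x j"] x by simp
  have "s x = (\<Sum>j\<in>Basis. \<Sum>i\<in>Basis. Rm x i j (H x j) \<bullet> i + c * (1 - (j \<bullet> i) * (j \<bullet> i)))"
    unfolding s_def
    by (intro sum.cong refl) (simp add: K_def 1 2 inner_add_left inner_diff_left)
  also have "\<dots> = coord_scalar g x + c * (\<Sum>j\<in>Basis. \<Sum>i\<in>(Basis::'a set). 1 - (j \<bullet> i) * (j \<bullet> i))"
    by (simp add: coord_scalar_eq[OF x] sum.distrib sum_distrib_left)
  also have "(\<Sum>j\<in>Basis. \<Sum>i\<in>(Basis::'a set). 1 - (j \<bullet> i) * (j \<bullet> i)) = (\<Sum>j\<in>(Basis::'a set). real DIM('a) - 1)"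
    by (rule sum.cong) (simp_all add: sum_subtractf euclidean_inner[symmetric] )
  finally show ?thesis by (simp add: algebra_simps)
qed

text \<open>The double trace of \<open>dd_V_K\<close>: since \<open>H\<close> is parallel, all
  connection terms cancel.\<close>

lemma dd_V_s:
  assumes x: "x \<in> S"
  shows "dd (V x) s x = - 2 * \<sigma> x * s x"
proof -
  let ?L = "\<Gamma> x (V x)"
  have lin: "linear ?L" by (simp add: blinfun.bounded_linear_right bounded_linear.linear)
  have diff: "(\<lambda>y. K y i j (H y j)) differentiable at x" for i j
  proof -
    have "smooth_on S (\<lambda>y. \<Sum>k\<in>Basis. (H y j \<bullet> k) *\<^sub>R K y i j k)"
      by (intro smooth_on_sum smooth_on_scaleR smooth_on_inner smooth_on_apply smooth_H smooth_K S smooth_on_const)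
    then have "smooth_on S (\<lambda>y. K y i j (H y j))"
      by (subst smooth_on_cong[OF S]) (rule linear_expand[OF linear_K(3)])
    then show ?thesis using smooth_on_differentiable x by blast
  qed
  \<comment> \<open>Of the two terms in the derivative of \<open>H\<close>, one cancels the
    correction for the last slot in \<open>dd_V_K\<close>; the transposed one is left for
    \<open>trace_adjoint\<close>.\<close>
  have dterm: "dd (V x) (\<lambda>y. K y i j (H y j)) x = - (2 * \<sigma> x) *\<^sub>R K x i j (H x j) - ?L (K x i j (H x j))
     + K x (?L i) j (H x j) + K x i (?L j) (H x j) - K x i j (H x (adjoint ?L j))" for i j
  proof -
    have "dd (V x) (\<lambda>y. K y i j (H y j)) x
        = dd (V x) (\<lambda>y. K y i j (H x j)) x + K x i j (dd (V x) (\<lambda>y. H y j) x)"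
      using x by (intro dd_linear_family[OF S x] linear_K) (auto intro: differentiable_apply)
    also have "dd (V x) (\<lambda>y. H y j) x = - ?L (H x j) - H x (adjoint ?L j)"
      using x by (simp add: dd_apply_const dd_H)
    also have "K x i j \<dots> = - K x i j (?L (H x j)) - K x i j (H x (adjoint ?L j))"
      by (simp add: linear_diff[OF linear_K(3)[OF x]] linear_neg[OF linear_K(3)[OF x]])
    finally show ?thesis by (simp add: dd_V_K[OF x])
  qed
  have "dd (V x) s x = (\<Sum>j\<in>Basis. \<Sum>i\<in>Basis. dd (V x) (\<lambda>y. K y i j (H y j)) x \<bullet> i)"
    unfolding s_def using diff
    by (simp add: dd_sum dd_inner_const differentiable_inner_at differentiable_sum)
  also have "\<dots> = - 2 * \<sigma> x * s x
     + (\<Sum>j\<in>Basis. (\<Sum>i\<in>Basis. K x (?L i) j (H x j) \<bullet> i) - (\<Sum>i\<in>Basis. ?L (K x i j (H x j)) \<bullet> i))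
     + ((\<Sum>j\<in>Basis. \<Sum>i\<in>Basis. K x i (?L j) (H x j) \<bullet> i) - (\<Sum>j\<in>Basis. \<Sum>i\<in>Basis. K x i j (H x (adjoint ?L j)) \<bullet> i))"
    unfolding dterm
    by (simp add: s_def inner_add_left inner_diff_left sum.distrib sum_subtractf sum_distrib_left sum_negf algebra_simps)
  \<comment> \<open>The corrections for the first slot and for the value form the trace of a
    commutator.\<close>
  also have "(\<Sum>j\<in>Basis. (\<Sum>i\<in>Basis. K x (?L i) j (H x j) \<bullet> i) - (\<Sum>i\<in>Basis. ?L (K x i j (H x j)) \<bullet> i)) = 0"
    by (intro sum.neutral ballI) (simp add: trace_commute[OF linear_K(1)[OF x] lin])
  also have "(\<Sum>j\<in>Basis. \<Sum>i\<in>Basis. K x i (?L j) (H x j) \<bullet> i)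
      = (\<Sum>j\<in>Basis. \<Sum>i\<in>Basis. K x i j (H x (adjoint ?L j)) \<bullet> i)"
  proof (subst sum.swap, subst (2) sum.swap, rule sum.cong[OF refl])
    fix i :: 'a
    show "(\<Sum>j\<in>Basis. K x i (?L j) (H x j) \<bullet> i) = (\<Sum>j\<in>Basis. K x i j (H x (adjoint ?L j)) \<bullet> i)"
    proof (rule trace_adjoint[OF lin, of "\<lambda>a b. K x i a (H x b) \<bullet> i"])
      show "linear (\<lambda>a. K x i a (H x b) \<bullet> i)" for b
        by (auto intro!: linearI simp: linear_add[OF linear_K(2)[OF x]] linear_cmul[OF linear_K(2)[OF x]] inner_add_left)
      show "linear (\<lambda>b. K x i a (H x b) \<bullet> i)" for a
        by (auto intro!: linearI simp: linear_add[OF linear_K(3)[OF x]] linear_cmul[OF linear_K(3)[OF x]]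
            inner_add_left blinfun.bilinear_simps)
    qed
  qed
  finally show ?thesis by simp
qed

lemma dd_h_eq_0:
  assumes c: "c \<noteq> 0" and scal: "\<And>y. y \<in> S \<Longrightarrow> \<sigma> y = coord_scalar g y - \<rho>" and x: "x \<in> S"
  shows "dd u h x = 0"
proof -
  \<comment> \<open>The constant \<open>s - \<sigma>\<close>: \<open>\<rho>\<close> comes from the
    definition of \<open>\<sigma>\<close>, the rest from \<open>s_eq\<close>.\<close>
  define \<kappa> where "\<kappa> = \<rho> + c * (real DIM('a) * real DIM('a) - real DIM('a))"
  have s: "s y = \<sigma> y + \<kappa>" if "y \<in> S" for y
    using that by (simp add: s_eq scal \<kappa>_def)
  \<comment> \<open>Two expressions for the derivative of \<open>s\<close> along \<open>V\<close>:
    the one from \<open>dd_V_s\<close>, and \<open>c |V|^2\<close> because \<open>s\<close> and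
    \<open>\<sigma>\<close> differ by a constant.\<close>
  have norm_V: "c * (G y (V y) \<bullet> V y) = - 2 * (\<sigma> y * (\<sigma> y + \<kappa>))" if y: "y \<in> S" for y
  proof -
    have "dd (V y) s y = dd (V y) (\<lambda>y. \<sigma> y + \<kappa>) y"
      by (rule dd_cong[OF S y s])
    also have "\<dots> = dd (V y) \<sigma> y"
      using y by (simp add: dd_add)
    also have "\<dots> = c * (G y (V y) \<bullet> V y)"
      using y by (simp add: d\<sigma> G_V)
    finally show ?thesis using dd_V_s[OF y] s[OF y] by simp
  qed
  \<comment> \<open>The derivative of \<open>norm_V\<close>, compared with \<open>dd_norm_V\<close>,
    gives \<open>2 \<sigma> dh = - 2 (2 \<sigma> + \<kappa>) dh\<close> after division by
    \<open>c\<close>.\<close>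
  have first: "dd u h y * (6 * \<sigma> y + 2 * \<kappa>) = 0" if y: "y \<in> S" for y
  proof -
    have "(\<lambda>z. G z (V z) \<bullet> V z) differentiable at y"
      using y by (intro differentiable_inner_at differentiable_apply) auto
    from dd_linear[OF bounded_linear_mult_right[of c] this, of u]
    have "c * (2 * \<sigma> y * dd u h y) = dd u (\<lambda>z. c * (G z (V z) \<bullet> V z)) y"
      by (simp add: dd_norm_V[OF y])
    also have "\<dots> = dd u (\<lambda>z. - 2 * (\<sigma> z * (\<sigma> z + \<kappa>))) y"
      by (rule dd_cong[OF S y norm_V])
    also have "\<dots> = - 2 * dd u (\<lambda>z. \<sigma> z * (\<sigma> z + \<kappa>)) y"
      using y by (intro dd_linear[OF bounded_linear_mult_right] differentiable_bilinear[OF bounded_bilinear_mult]) auto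
    also have "dd u (\<lambda>z. \<sigma> z * (\<sigma> z + \<kappa>)) y = (2 * \<sigma> y + \<kappa>) * dd u \<sigma> y"
      using y by (simp add: dd_bilinear[OF bounded_bilinear_mult] dd_add) (simp add: algebra_simps)
    finally have "c * (2 * \<sigma> y * dd u h y) = - 2 * ((2 * \<sigma> y + \<kappa>) * (c * dd u h y))"
      by (simp only: d\<sigma>[OF y])
    moreover have "c * (dd u h y * (6 * \<sigma> y + 2 * \<kappa>))
        = c * (2 * \<sigma> y * dd u h y) + 2 * ((2 * \<sigma> y + \<kappa>) * (c * dd u h y))"
      by (simp add: algebra_simps)
    ultimately have "c * (dd u h y * (6 * \<sigma> y + 2 * \<kappa>)) = 0" by linarith
    then show ?thesis using c by simp
  qed
  have "0 = dd u (\<lambda>y. dd u h y * (6 * \<sigma> y + 2 * \<kappa>)) x"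
    by (subst dd_cong[OF S x first]) simp_all
  also have "\<dots> = dd u h x * (6 * dd u \<sigma> x) + dd u (dd u h) x * (6 * \<sigma> x + 2 * \<kappa>)"
    using x by (simp add: dd_bilinear[OF bounded_bilinear_mult] dd_add)
  \<comment> \<open>Multiplication by \<open>dd u h x\<close> removes the second-derivative term by
    \<open>first\<close>.\<close>
  finally have "dd u h x * (dd u h x * (6 * dd u \<sigma> x)) = 0"
    using first[OF x] by auto
  then show ?thesis using c by (simp add: d\<sigma>[OF x])
qed

end

lemma dd_split:
  assumes "f differentiable at x"
  shows "dd (a, b) f x = dd (a, 0) f x + dd (0, b) f x"
  using dd_direction_add[OF assms, of "(a, 0)" "(0, b)"] by simp

text \<open>A derivative is linear in its direction, so a varying direction adds a first-order term.
  The directions in question are connection terms and the gradient of \<open>f\<close>.\<close>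

lemma dd_moving_direction:
  fixes f :: "'a::euclidean_space \<Rightarrow> 'b::real_normed_vector"
  assumes "open S" "x \<in> S" "smooth_on S f" "k differentiable at x"
  shows "dd w (\<lambda>q. dd (k q) f q) x = dd w (dd (k x) f) x + dd (dd w k x) f x"
proof (rule dd_linear_family[OF assms(1,2), of "\<lambda>q v. dd v f q"])
  show "linear (\<lambda>v. dd v f q)" if "q \<in> S" for q
    by (rule linear_frechet_derivative[OF smooth_on_differentiable[OF assms(3) that]])
  show "dd v f differentiable at x" for v
    by (rule smooth_on_differentiable[OF smooth_on_dd[OF assms(3)] assms(2)])
qed (rule assms(4))

section \<open>Warped products in coordinates\<close>

text \<open>The situation in one product chart. The equation for \<open>Hess f\<close> is carried by
  the instance \<open>B\<close>, so \<open>B.V\<close> is the gradient of \<open>f\<close>.\<close>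

locale warped_hessian =
  B: conformal_hessian SB gB f "\<lambda>x. c * f x" +
  F: coordinate_metric SF gF +
  M: conformal_hessian "SB \<times> SF" gM h \<sigma>
  for SB :: "'a::euclidean_space set" and gB f c and SF :: "'b::euclidean_space set" and gF gM h \<sigma> +
  assumes f_pos: "x \<in> SB \<Longrightarrow> f x > 0"
    and gM: "p \<in> SB \<times> SF \<Longrightarrow>
      gM p u v = gB (fst p) (fst u) (fst v) + (f (fst p))\<^sup>2 * gF (snd p) (snd u) (snd v)"
begin

lemma G_M: "p \<in> SB \<times> SF \<Longrightarrow>
    M.G p u \<bullet> v = B.G (fst p) (fst u) \<bullet> fst v + (f (fst p))\<^sup>2 * (F.G (snd p) (snd u) \<bullet> snd v)"
  by (auto simp: M.G_inner B.G_inner F.G_inner gM)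

lemma dd_G_M:
  assumes p: "p \<in> SB \<times> SF"
  shows "dd w M.G p u \<bullet> v = dd (fst w) B.G (fst p) (fst u) \<bullet> fst v
     + 2 * f (fst p) * dd (fst w) f (fst p) * (F.G (snd p) (snd u) \<bullet> snd v)
     + (f (fst p))\<^sup>2 * (dd (snd w) F.G (snd p) (snd u) \<bullet> snd v)"
proof -
  have in_dom: "fst p \<in> SB" "snd p \<in> SF" using p by auto
  let ?b = "\<lambda>x. B.G x (fst u) \<bullet> fst v" and ?f = "\<lambda>y. F.G y (snd u) \<bullet> snd v"
  have diff: "?b differentiable at (fst p)" "?f differentiable at (snd p)"
    "(\<lambda>x. (f x)\<^sup>2) differentiable at (fst p)"
    using in_dom by (auto intro!: differentiable_inner_at differentiable_apply differentiable_power)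
  have "dd w M.G p u \<bullet> v = dd w (\<lambda>p. M.G p u \<bullet> v) p"
    using p by (simp add: dd_inner_const dd_apply_const differentiable_apply)
  also have "\<dots> = dd w (\<lambda>p. ?b (fst p) + (f (fst p))\<^sup>2 * ?f (snd p)) p"
    by (rule dd_cong[OF M.S p]) (rule G_M)
  also have "\<dots> = dd (fst w) ?b (fst p) + ((f (fst p))\<^sup>2 * dd (snd w) ?f (snd p) + dd (fst w) (\<lambda>x. (f x)\<^sup>2) (fst p) * ?f (snd p))"
    using dd_fst[OF diff(1)] dd_snd[OF diff(2)] dd_fst[OF diff(3)]
    by (subst dd_add) (auto simp: dd_bilinear[OF bounded_bilinear_mult] intro: differentiable_bilinear[OF bounded_bilinear_mult])
  also have "dd (fst w) (\<lambda>x. (f x)\<^sup>2) (fst p) = 2 * f (fst p) * dd (fst w) f (fst p)"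
    unfolding power2_eq_square using in_dom by (simp add: dd_bilinear[OF bounded_bilinear_mult])
  finally show ?thesis
    using in_dom by (simp add: dd_inner_const dd_apply_const differentiable_apply)
qed

section \<open>Connection and Hessian components of a warped product\<close>

context
  fixes p assumes p: "p \<in> SB \<times> SF"
begin

lemma p_fst: "fst p \<in> SB" and p_snd: "snd p \<in> SF"
  using p by auto

lemma f_pos_p: "f (fst p) > 0"
  using f_pos[OF p_fst] .

text \<open>Along the base the fiber block varies only through \<open>f\<^sup>2\<close>, and half
  the logarithmic derivative of that factor is \<open>df / f\<close>.\<close>

lemma \<Gamma>_mixed: "M.\<Gamma> p (i, 0) (0, u) = (0, (dd i f (fst p) / f (fst p)) *\<^sub>R u)"
proof (rule M.\<Gamma>_eqI[OF p])
  fix w :: "'a \<times> 'b"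
  define r where "r = dd i f (fst p) / f (fst p)"
  have r: "dd i f (fst p) = f (fst p) * r"
    using f_pos_p by (simp add: r_def)
  let ?X = "F.G (snd p) u \<bullet> snd w"
  have "2 * (M.G p (0, r *\<^sub>R u) \<bullet> w) = 2 * ((f (fst p))\<^sup>2 * (r * ?X))"
    by (simp add: G_M[OF p] blinfun.bilinear_simps)
  also have "\<dots> = 2 * f (fst p) * (f (fst p) * r) * ?X"
    by (simp add: power2_eq_square)
  also have "\<dots> = dd (i, 0) M.G p (0, u) \<bullet> w + dd (0, u) M.G p (i, 0) \<bullet> w - dd w M.G p (i, 0) \<bullet> (0, u)"
    by (simp add: dd_G_M[OF p] dd_direction_zero p_fst p_snd r)
  finally show "2 * (M.G p (0, (dd i f (fst p) / f (fst p)) *\<^sub>R u) \<bullet> w)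
      = dd (i, 0) M.G p (0, u) \<bullet> w + dd (0, u) M.G p (i, 0) \<bullet> w - dd w M.G p (i, 0) \<bullet> (0, u)"
    by (simp only: r_def)
qed

text \<open>The base leaves are totally geodesic, the base block being constant along the
  fiber.\<close>

lemma \<Gamma>_base: "M.\<Gamma> p (i, 0) (j, 0) = (B.\<Gamma> (fst p) i j, 0)"
  by (rule M.\<Gamma>_eqI[OF p])
     (simp add: G_M[OF p] dd_G_M[OF p] dd_direction_zero p_fst p_snd B.koszul)

text \<open>The base part is the second fundamental form of the fibers, caused by the growth of
  \<open>f\<^sup>2\<close>; in the fiber part the factor \<open>f\<^sup>2\<close> cancels.\<close>

lemma \<Gamma>_fiber: "M.\<Gamma> p (0, u) (0, v)
    = (- (f (fst p) * (F.G (snd p) u \<bullet> v)) *\<^sub>R B.V (fst p), F.\<Gamma> (snd p) u v)"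
proof (rule M.\<Gamma>_eqI[OF p])
  fix w :: "'a \<times> 'b"
  have "2 * ((f (fst p))\<^sup>2 * (F.G (snd p) (F.\<Gamma> (snd p) u v) \<bullet> snd w))
      = (f (fst p))\<^sup>2 * (dd u F.G (snd p) v \<bullet> snd w + dd v F.G (snd p) u \<bullet> snd w - dd (snd w) F.G (snd p) u \<bullet> v)"
    using F.koszul[OF p_snd, of u v "snd w"] by simp
  then show "2 * (M.G p (- (f (fst p) * (F.G (snd p) u \<bullet> v)) *\<^sub>R B.V (fst p), F.\<Gamma> (snd p) u v) \<bullet> w)
      = dd (0, u) M.G p (0, v) \<bullet> w + dd (0, v) M.G p (0, u) \<bullet> w - dd w M.G p (0, u) \<bullet> (0, v)"
    by (simp add: G_M[OF p] dd_G_M[OF p] dd_direction_zero p_fst p_snd blinfun.bilinear_simps B.G_V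
        right_diff_distrib distrib_left)
qed

text \<open>Base and fiber are orthogonal, so the mixed Hessian vanishes; only the connection term
  with \<open>df / f\<close> is left, cleared of its denominator.\<close>

lemma hess_mixed: "f (fst p) * dd (i, 0) (dd (0, u) h) p = dd i f (fst p) * dd (0, u) h p"
proof -
  have "dd (M.\<Gamma> p (i, 0) (0, u)) h p = dd i f (fst p) / f (fst p) * dd (0, u) h p"
    using dd_direction_scale[OF M.diff_h[OF p], of "dd i f (fst p) / f (fst p)" "(0, u)"]
    by (simp add: \<Gamma>_mixed)
  then show ?thesis
    using M.hessian[OF p, where u = "(i, 0)" and v = "(0, u)"] f_pos_p
    by (simp add: G_M[OF p] field_simps)
qed

lemma hess_base:
  "dd (i, 0) (dd (j, 0) h) p - dd (B.\<Gamma> (fst p) i j, 0) h p = \<sigma> p * (B.G (fst p) i \<bullet> j)"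
  using M.hessian[OF p, where u = "(i, 0)" and v = "(j, 0)"]
  by (simp add: G_M[OF p] \<Gamma>_base)

lemma hess_fiber:
  "dd (0, u) (dd (0, v) h) p - dd (0, F.\<Gamma> (snd p) u v) h p
     = (F.G (snd p) u \<bullet> v) * ((f (fst p))\<^sup>2 * \<sigma> p - f (fst p) * dd (B.V (fst p), 0) h p)"
proof -
  let ?r = "- (f (fst p) * (F.G (snd p) u \<bullet> v))"
  have "dd (M.\<Gamma> p (0, u) (0, v)) h p = ?r * dd (B.V (fst p), 0) h p + dd (0, F.\<Gamma> (snd p) u v) h p"
    using dd_direction_scale[OF M.diff_h[OF p], of ?r "(B.V (fst p), 0)"]
      dd_split[OF M.diff_h[OF p], of "?r *\<^sub>R B.V (fst p)" "F.\<Gamma> (snd p) u v"]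
    by (simp add: \<Gamma>_fiber)
  then show ?thesis
    using M.hessian[OF p, where u = "(0, u)" and v = "(0, v)"]
    by (simp add: G_M[OF p] algebra_simps)
qed

end

section \<open>Differentiating the Hessian components to relate \<open>\<sigma>\<close> and
  \<open>h\<close>\<close>

lemma smooth_dd_h: "smooth_on (SB \<times> SF) (dd u h)"
  by (rule smooth_on_dd[OF M.h_smooth])

lemma diff_dd_dd_h [simp]: "p \<in> SB \<times> SF \<Longrightarrow> dd v (dd u h) differentiable at p"
  using smooth_on_differentiable[OF smooth_on_dd[OF smooth_dd_h]] .

lemmas dd_h_commute = dd_commute[OF M.S _ M.h_smooth]
lemmas dd_dd_h_commute = dd_commute[OF M.S _ smooth_dd_h]

text \<open>For \<open>w = dd (0, u) h\<close> the mixed equation \<open>f w_i = f_i w\<close>,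
  differentiated once more along \<open>i\<close>, gives \<open>f w_ii = f_ii w\<close>. So the base
  Hessian of \<open>w\<close> in direction \<open>i\<close> is \<open>w / f\<close> times that of
  \<open>f\<close>, namely \<open>c w\<close> times the base metric; by \<open>hess_base\<close>
  differentiated along the fiber it is also \<open>dd (0, u) \<sigma>\<close> times that
  metric.\<close>

lemma dd_\<sigma>_fiber:
  assumes p: "p \<in> SB \<times> SF"
  shows "dd (0, u) \<sigma> p = c * dd (0, u) h p"
proof -
  note in_dom = p_fst[OF p] p_snd[OF p]
  obtain i :: 'a where "i \<in> Basis" using nonempty_Basis by blast
  then have i: "B.G (fst p) i \<bullet> i > 0" using B.G_pos[OF in_dom(1) nonzero_Basis] by blast
  let ?f = "f (fst p)" and ?fi = "dd i f (fst p)" and ?hu = "dd (0, u) h p"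
    and ?A = "dd (i, 0) (dd (0, u) h)"
  have fst_diff: "(\<lambda>q. f (fst q)) differentiable at p" "(\<lambda>q. dd i f (fst q)) differentiable at p"
    using in_dom by (auto intro: dd_fst)
  have fst_dd: "dd w (\<lambda>q. dd i f (fst q)) p = dd (fst w) (dd i f) (fst p)" for w
    using in_dom by (intro dd_fst) auto
  have "dd (i, 0) (\<lambda>q. f (fst q) * ?A q) p = dd (i, 0) (\<lambda>q. dd i f (fst q) * dd (0, u) h q) p"
    by (rule dd_cong[OF M.S p]) (rule hess_mixed)
  then have 1: "?f * dd (i, 0) ?A p + ?fi * ?A p = ?fi * ?A p + dd i (dd i f) (fst p) * ?hu"
    using p in_dom by (simp add: dd_bilinear[OF bounded_bilinear_mult] fst_diff fst_dd dd_fst)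
  have 2: "?f * dd (i, 0) ?A p = dd i (dd i f) (fst p) * ?hu"
    using 1 by simp
  have 3: "dd (0, u) (dd (i, 0) (dd (i, 0) h)) p = dd (i, 0) ?A p"
  proof -
    have "dd (0, u) (dd (i, 0) (dd (i, 0) h)) p = dd (i, 0) (dd (0, u) (dd (i, 0) h)) p"
      by (rule dd_dd_h_commute[OF p])
    also have "\<dots> = dd (i, 0) ?A p"
      by (rule dd_cong[OF M.S p]) (rule dd_h_commute)
    finally show ?thesis .
  qed
  have k: "(\<lambda>q. (B.\<Gamma> (fst q) i i, 0::'b)) differentiable at p"
    "dd (0, u) (\<lambda>q. (B.\<Gamma> (fst q) i i, 0::'b)) p = 0"
  proof -
    have L: "bounded_linear (\<lambda>v::'a. (v, 0::'b))"
      by (intro bounded_linear_Pair bounded_linear_ident bounded_linear_zero)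
    have d: "(\<lambda>x. B.\<Gamma> x i i) differentiable at (fst p)"
      using in_dom by (intro differentiable_apply) auto
    show "(\<lambda>q. (B.\<Gamma> (fst q) i i, 0::'b)) differentiable at p"
      by (rule differentiable_linear[OF L dd_fst(2)[OF d]])
    show "dd (0, u) (\<lambda>q. (B.\<Gamma> (fst q) i i, 0::'b)) p = 0"
      by (simp add: dd_linear[OF L dd_fst(2)[OF d]] dd_fst(1)[OF d] dd_direction_zero[OF d] zero_prod_def)
  qed
  let ?k = "B.\<Gamma> (fst p) i i"
  \<comment> \<open>The base connection is constant along the fiber, so only \<open>h\<close> gets
    differentiated.\<close>
  have 4: "dd (0, u) (\<lambda>q. dd (B.\<Gamma> (fst q) i i, 0) h q) p = dd (?k, 0) (dd (0, u) h) p"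
    using dd_moving_direction[OF M.S p M.h_smooth k(1), of "(0, u)"] dd_h_commute[OF p]
    by (simp add: k(2) dd_direction_zero p)
  have "dd (0, u) (\<lambda>q. dd (i, 0) (dd (i, 0) h) q - dd (B.\<Gamma> (fst q) i i, 0) h q) p
      = dd (0, u) (\<lambda>q. \<sigma> q * (B.G (fst q) i \<bullet> i)) p"
    by (rule dd_cong[OF M.S p]) (rule hess_base)
  \<comment> \<open>Regularity of this term with moving direction is read off from the Hessian
    equation, whose other terms are smooth.\<close>
  moreover have "(\<lambda>q. dd (B.\<Gamma> (fst q) i i, 0) h q) differentiable at p"
  proof -
    have "smooth_on (SB \<times> SF) (\<lambda>q. dd (i, 0) (dd (i, 0) h) q - \<sigma> q * (M.G q (i, 0) \<bullet> (i, 0)))"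
      by (intro smooth_on_diff smooth_on_dd smooth_dd_h smooth_on_inner smooth_on_apply smooth_on_const
          smooth_on_mult smooth_on_scaleR M.smooth_\<sigma> M.smooth_G M.S)
    then have "smooth_on (SB \<times> SF) (\<lambda>q. dd (B.\<Gamma> (fst q) i i, 0) h q)"
      by (subst smooth_on_cong[OF M.S]) (use hess_base in \<open>auto simp: G_M algebra_simps\<close>)
    then show ?thesis using smooth_on_differentiable p by blast
  qed
  moreover have "dd (0, u) (\<lambda>q. \<sigma> q * (B.G (fst q) i \<bullet> i)) p = dd (0, u) \<sigma> p * (B.G (fst p) i \<bullet> i)"
  proof -
    have d: "(\<lambda>x. B.G x i \<bullet> i) differentiable at (fst p)"
      using in_dom by (intro differentiable_inner_at differentiable_apply) auto
    show ?thesis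
      using p by (simp add: dd_bilinear[OF bounded_bilinear_mult] dd_fst[OF d] dd_direction_zero[OF d])
  qed
  ultimately have "dd (i, 0) ?A p - dd (?k, 0) (dd (0, u) h) p = dd (0, u) \<sigma> p * (B.G (fst p) i \<bullet> i)"
    using p by (simp add: dd_diff 3 4)
  then have "?f * (dd (0, u) \<sigma> p * (B.G (fst p) i \<bullet> i)) = (dd i (dd i f) (fst p) - dd ?k f (fst p)) * ?hu"
    using 2 hess_mixed[OF p, where i = ?k and u = u] by (simp add: algebra_simps)
  also have "\<dots> = ?f * (c * ?hu * (B.G (fst p) i \<bullet> i))"
    by (simp add: B.hessian[OF in_dom(1)])
  finally show ?thesis using i f_pos_p[OF p] by simp
qed

text \<open>The function is the base inner product of the gradients of \<open>f\<close> and
  \<open>h\<close>. The Hessian of \<open>f\<close> contributes \<open>c f dh\<close>, the base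
  Hessian of \<open>h\<close> contributes \<open>\<sigma> df\<close>.\<close>

lemma dd_gradient_product:
  assumes p: "p \<in> SB \<times> SF"
  shows "(\<lambda>q. dd (B.V (fst q), 0) h q) differentiable at p"
    and "dd (i, 0) (\<lambda>q. dd (B.V (fst q), 0) h q) p
      = c * f (fst p) * dd (i, 0) h p + \<sigma> p * dd i f (fst p)"
proof -
  note in_dom = p_fst[OF p] p_snd[OF p]
  have L: "bounded_linear (\<lambda>v::'a. (v, 0::'b))"
    by (intro bounded_linear_Pair bounded_linear_ident bounded_linear_zero)
  have k: "(\<lambda>q. (B.V (fst q), 0::'b)) differentiable at p"
    "dd (i, 0) (\<lambda>q. (B.V (fst q), 0::'b)) p = ((c * f (fst p)) *\<^sub>R i - B.\<Gamma> (fst p) i (B.V (fst p)), 0)"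
    using in_dom
    by (auto intro!: differentiable_linear[OF L] dd_fst(2) simp: dd_linear[OF L] dd_fst B.dd_V)
  \<comment> \<open>A pairing of smooth fields, since \<open>smooth_on_dd\<close> covers only fixed
    directions.\<close>
  have "smooth_on (SB \<times> SF) (\<lambda>q. M.G q (M.V q) \<bullet> (B.V (fst q), 0))"
    by (intro smooth_on_inner smooth_on_apply M.smooth_G M.smooth_V M.S smooth_on_linear[OF M.S L]
        smooth_on_compose_linear[OF bounded_linear_fst B.S M.S _ B.smooth_V]) auto
  then have "smooth_on (SB \<times> SF) (\<lambda>q. dd (B.V (fst q), 0) h q)"
    by (subst smooth_on_cong[OF M.S, of _ "\<lambda>q. M.G q (M.V q) \<bullet> (B.V (fst q), 0)"]) (simp_all add: M.G_V)
  then show "(\<lambda>q. dd (B.V (fst q), 0) h q) differentiable at p"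
    using smooth_on_differentiable p by blast
  have dir: "dd (a *\<^sub>R i - b, 0) h p = a * dd (i, 0) h p - dd (b, 0) h p" for a b
    using dd_direction_add[OF M.diff_h[OF p], of "a *\<^sub>R (i, 0)" "(-1) *\<^sub>R (b, 0)"]
      dd_direction_scale[OF M.diff_h[OF p], of a "(i, 0)"]
      dd_direction_scale[OF M.diff_h[OF p], of "-1" "(b, 0)"] by simp
  have "dd (i, 0) (\<lambda>q. dd (B.V (fst q), 0) h q) p
      = dd (i, 0) (dd (B.V (fst p), 0) h) p + (c * f (fst p) * dd (i, 0) h p - dd (B.\<Gamma> (fst p) i (B.V (fst p)), 0) h p)"
    using dd_moving_direction[OF M.S p M.h_smooth k(1), of "(i, 0)"] by (simp add: k(2) dir)
  then show "dd (i, 0) (\<lambda>q. dd (B.V (fst q), 0) h q) p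
      = c * f (fst p) * dd (i, 0) h p + \<sigma> p * dd i f (fst p)"
    using hess_base[OF p, where i = i and j = "B.V (fst p)"] B.G_sym[OF in_dom(1), of i "B.V (fst p)"] in_dom
    by (simp add: B.G_V)
qed

text \<open>The fiber Hessian \<open>T\<close> of \<open>h\<close> combines fiber derivatives with
  coefficients constant along the base, so it inherits \<open>f T_i = f_i T\<close> from
  \<open>hess_mixed\<close>. Evaluating \<open>T\<close> by \<open>hess_fiber\<close> turns this
  into \<open>f^3 (d\<sigma> - c dh) = 0\<close> up to a positive factor.\<close>

lemma dd_\<sigma>_base:
  assumes p: "p \<in> SB \<times> SF"
  shows "dd (i, 0) \<sigma> p = c * dd (i, 0) h p"
proof -
  note in_dom = p_fst[OF p] p_snd[OF p]
  obtain b :: 'b where "b \<in> Basis" using nonempty_Basis by blast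
  then have \<gamma>_pos: "F.G (snd p) b \<bullet> b > 0" using F.G_pos[OF in_dom(2) nonzero_Basis] by blast
  let ?f = "f (fst p)" and ?fi = "dd i f (fst p)" and ?\<gamma> = "\<lambda>q. F.G (snd q) b \<bullet> b"
  let ?P = "\<lambda>q. dd (B.V (fst q), 0) h q"
  let ?A = "dd (i, 0) (dd (0, b) h)" and ?k = "F.\<Gamma> (snd p) b b"
  define T where "T q = dd (0, b) (dd (0, b) h) q - dd (0, F.\<Gamma> (snd q) b b) h q" for q
  have fst_diff: "(\<lambda>q. f (fst q)) differentiable at p" "(\<lambda>q. dd i f (fst q)) differentiable at p"
    using in_dom by (auto intro: dd_fst)
  have fst_dd: "dd w (\<lambda>q. dd i f (fst q)) p = dd (fst w) (dd i f) (fst p)" for w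
    using in_dom by (intro dd_fst) auto
  have \<gamma>: "?\<gamma> differentiable at p" "dd (i, 0) ?\<gamma> p = 0"
  proof -
    have d: "(\<lambda>x. F.G x b \<bullet> b) differentiable at (snd p)"
      using in_dom by (intro differentiable_inner_at differentiable_apply) auto
    show "?\<gamma> differentiable at p" "dd (i, 0) ?\<gamma> p = 0"
      using dd_snd[OF d] by (simp_all add: dd_direction_zero[OF d])
  qed
  have "dd (0, b) (\<lambda>q. f (fst q) * ?A q) p = dd (0, b) (\<lambda>q. dd i f (fst q) * dd (0, b) h q) p"
    by (rule dd_cong[OF M.S p]) (rule hess_mixed)
  then have 1: "?f * dd (0, b) ?A p = ?fi * dd (0, b) (dd (0, b) h) p"
    using p in_dom by (simp add: dd_bilinear[OF bounded_bilinear_mult] fst_diff fst_dd dd_fst dd_direction_zero)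
  have 2: "dd (i, 0) (dd (0, b) (dd (0, b) h)) p = dd (0, b) ?A p"
    by (rule dd_dd_h_commute[OF p])
  have k: "(\<lambda>q. (0::'a, F.\<Gamma> (snd q) b b)) differentiable at p"
    "dd (i, 0) (\<lambda>q. (0::'a, F.\<Gamma> (snd q) b b)) p = 0"
  proof -
    have L: "bounded_linear (\<lambda>v::'b. (0::'a, v))"
      by (intro bounded_linear_Pair bounded_linear_ident bounded_linear_zero)
    have d: "(\<lambda>x. F.\<Gamma> x b b) differentiable at (snd p)"
      using in_dom by (intro differentiable_apply) auto
    show "(\<lambda>q. (0::'a, F.\<Gamma> (snd q) b b)) differentiable at p"
      by (rule differentiable_linear[OF L dd_snd(2)[OF d]])
    show "dd (i, 0) (\<lambda>q. (0::'a, F.\<Gamma> (snd q) b b)) p = 0"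
      by (simp add: dd_linear[OF L dd_snd(2)[OF d]] dd_snd(1)[OF d] dd_direction_zero[OF d] zero_prod_def)
  qed
  have T_eq: "T q = ?\<gamma> q * ((f (fst q))\<^sup>2 * \<sigma> q - f (fst q) * ?P q)" if "q \<in> SB \<times> SF" for q
    unfolding T_def by (rule hess_fiber[OF that])
  have dP: "?P differentiable at p" by (rule dd_gradient_product[OF p])
  have dW: "(\<lambda>q. (f (fst q))\<^sup>2 * \<sigma> q) differentiable at p" "(\<lambda>q. f (fst q) * ?P q) differentiable at p"
    using p fst_diff dP by (auto intro!: differentiable_bilinear[OF bounded_bilinear_mult] differentiable_power)
  \<comment> \<open>Differentiability of \<open>T\<close> comes from the right-hand side of
    \<open>T_eq\<close>, and passes from there to the term with moving direction in
    \<open>T_def\<close>.\<close>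
  have "T differentiable at p
      \<longleftrightarrow> (\<lambda>q. ?\<gamma> q * ((f (fst q))\<^sup>2 * \<sigma> q - f (fst q) * ?P q)) differentiable at p"
    by (rule differentiable_cong_open[OF M.S p]) (rule T_eq)
  then have dT: "T differentiable at p"
    by (simp only: differentiable_bilinear[OF bounded_bilinear_mult \<gamma>(1) differentiable_diff[OF dW]])
  have dY: "(\<lambda>q. dd (0, F.\<Gamma> (snd q) b b) h q) differentiable at p"
    using differentiable_diff[OF diff_dd_dd_h[OF p, of "(0, b)" "(0, b)"] dT] by (simp add: T_def)
  have "?f * dd (i, 0) T p = ?f * (dd (0, b) ?A p - dd (i, 0) (dd (0, ?k) h) p)"
    unfolding T_def
    using dd_moving_direction[OF M.S p M.h_smooth k(1), of "(i, 0)"]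
    by (simp add: dd_diff[OF diff_dd_dd_h[OF p] dY] 2 k(2) dd_direction_zero p)
  then have T1: "?f * dd (i, 0) T p = ?fi * T p"
    using 1 hess_mixed[OF p, where i = i and u = ?k] by (simp add: right_diff_distrib T_def)
  have "dd (i, 0) T p = dd (i, 0) (\<lambda>q. ?\<gamma> q * ((f (fst q))\<^sup>2 * \<sigma> q - f (fst q) * ?P q)) p"
    by (rule dd_cong[OF M.S p T_eq])
  also have "\<dots> = ?\<gamma> p * (dd (i, 0) (\<lambda>q. (f (fst q))\<^sup>2 * \<sigma> q) p - dd (i, 0) (\<lambda>q. f (fst q) * ?P q) p)"
    by (simp add: dd_bilinear[OF bounded_bilinear_mult \<gamma>(1) differentiable_diff[OF dW]] \<gamma>(2) dd_diff[OF dW])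
  also have "dd (i, 0) (\<lambda>q. (f (fst q))\<^sup>2 * \<sigma> q) p = ?f\<^sup>2 * dd (i, 0) \<sigma> p + 2 * ?f * ?fi * \<sigma> p"
    using p fst_diff in_dom
    by (simp add: power2_eq_square dd_bilinear[OF bounded_bilinear_mult]
        differentiable_bilinear[OF bounded_bilinear_mult] dd_fst)
  also have "dd (i, 0) (\<lambda>q. f (fst q) * ?P q) p
      = ?f * (c * ?f * dd (i, 0) h p + \<sigma> p * ?fi) + ?fi * ?P p"
    using fst_diff(1) dP in_dom
    by (simp add: dd_bilinear[OF bounded_bilinear_mult] dd_fst dd_gradient_product(2)[OF p])
  finally have T2: "dd (i, 0) T p = ?\<gamma> p * (?f\<^sup>2 * dd (i, 0) \<sigma> p + 2 * ?f * ?fi * \<sigma> p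
      - (?f * (c * ?f * dd (i, 0) h p + \<sigma> p * ?fi) + ?fi * ?P p))" .
  \<comment> \<open>In this combination the terms with \<open>\<sigma> df\<close> and with
    \<open>?P\<close> cancel.\<close>
  have "?\<gamma> p * (?f ^ 3 * (dd (i, 0) \<sigma> p - c * dd (i, 0) h p)) = ?f * dd (i, 0) T p - ?fi * T p"
    unfolding T2 T_eq[OF p] by (simp add: algebra_simps power2_eq_square power3_eq_cube)
  then have "?\<gamma> p * (?f ^ 3 * (dd (i, 0) \<sigma> p - c * dd (i, 0) h p)) = 0"
    using T1 by simp
  then show ?thesis
    using \<gamma>_pos f_pos_p[OF p] by simp
qed

lemma dd_\<sigma>:
  assumes p: "p \<in> SB \<times> SF"
  shows "dd u \<sigma> p = c * dd u h p"
  using dd_split[OF M.diff_\<sigma>[OF p], of "fst u" "snd u"] dd_split[OF M.diff_h[OF p], of "fst u" "snd u"]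
    dd_\<sigma>_fiber[OF p] dd_\<sigma>_base[OF p] by (simp add: distrib_left)

lemma trivial_soliton:
  assumes c: "c \<noteq> 0" and scal: "\<And>q. q \<in> SB \<times> SF \<Longrightarrow> \<sigma> q = coord_scalar gM q - \<rho>"
    and p: "p \<in> SB \<times> SF"
  shows "dd u h p = 0" and "coord_scalar gM p = \<rho>"
proof -
  interpret M: concircular "SB \<times> SF" gM h \<sigma> c
    by unfold_locales (rule dd_\<sigma>)
  show h0: "dd u h p = 0" for u
    by (rule M.dd_h_eq_0[OF c scal p])
  obtain i :: "'a \<times> 'b" where "i \<in> Basis" using nonempty_Basis by blast
  then have "M.G p i \<bullet> i > 0" using M.G_pos[OF p nonzero_Basis] by blast
  moreover have "dd i (dd i h) p = dd i (\<lambda>_. 0) p"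
    by (rule dd_cong[OF M.S p]) (rule M.dd_h_eq_0[OF c scal])
  ultimately have "\<sigma> p = 0"
    using M.hessian[OF p, where u = i and v = i] h0 by simp
  then show "coord_scalar gM p = \<rho>"
    by (simp add: scal[OF p])
qed

end

section \<open>Manifolds\<close>

text \<open>For locally constant \<open>h\<close>, every condition on the value of \<open>h\<close>
  defines an open set; level sets are therefore clopen.\<close>

lemma locally_constant_imp_constant_on:
  assumes "connected_space X"
    and loc: "\<And>p. p \<in> topspace X \<Longrightarrow> \<exists>U. openin X U \<and> p \<in> U \<and> (\<forall>q\<in>U. h q = h p)"
  shows "h constant_on topspace X"
proof (cases "topspace X = {}")
  case True
  then show ?thesis by (simp add: constant_on_def)
next
  case False
  then obtain p where p: "p \<in> topspace X" by blast
  have op: "openin X {q \<in> topspace X. P (h q)}" for P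
  proof (rule iffD2[OF openin_subopen], rule ballI)
    fix q assume "q \<in> {q \<in> topspace X. P (h q)}"
    then have q: "q \<in> topspace X" "P (h q)" by auto
    from loc[OF q(1)] obtain U where U: "openin X U" "q \<in> U" "\<forall>r\<in>U. h r = h q" by blast
    have "r \<in> topspace X \<and> P (h r)" if "r \<in> U" for r
      using openin_subset[OF U(1)] U(3) q(2) that by (metis subsetD)
    then have "U \<subseteq> {q \<in> topspace X. P (h q)}" by blast
    then show "\<exists>T. openin X T \<and> q \<in> T \<and> T \<subseteq> {q \<in> topspace X. P (h q)}"
      using U(1,2) by blast
  qed
  have "topspace X - {q \<in> topspace X. h q = h p} = {q \<in> topspace X. h q \<noteq> h p}" by auto
  then have "closedin X {q \<in> topspace X. h q = h p}"
    using op[of "\<lambda>r. r \<noteq> h p"] by (simp add: closedin_def)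
  then have "{q \<in> topspace X. h q = h p} = {} \<or> {q \<in> topspace X. h q = h p} = topspace X"
    using spec[OF assms(1)[unfolded connected_space_clopen_in], of "{q \<in> topspace X. h q = h p}"]
      op[of "\<lambda>r. r = h p"] by blast
  then show ?thesis
    unfolding constant_on_def using p by blast
qed

locale smooth_manifold_locale =
  fixes M :: "('p, 'e::euclidean_space) manifold"
  assumes smooth_manifold: "smooth_manifold M"
begin

context
  fixes c assumes c: "c \<in> atlas M"
begin

lemma chart_open: "openin (topo M) (fst c)" and chart_image_open: "open (snd c ` fst c)"
  and chart_homeo: "homeomorphic_map (subtopology (topo M) (fst c)) (top_of_set (snd c ` fst c)) (snd c)"
  using smooth_manifold c unfolding smooth_manifold_def by blast+

lemma chart_subset: "fst c \<subseteq> points M"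
  using openin_subset[OF chart_open] .

lemma topspace_chart: "topspace (subtopology (topo M) (fst c)) = fst c"
  using chart_subset by auto

lemma chart_inj: "inj_on (snd c) (fst c)"
  using homeomorphic_imp_injective_map[OF chart_homeo] unfolding topspace_chart .

lemma chart_inv_chart [simp]: "p \<in> fst c \<Longrightarrow> chart_inv c (snd c p) = p"
  unfolding chart_inv_def by (rule inv_into_f_f[OF chart_inj])

lemma chart_inv_in: "x \<in> snd c ` fst c \<Longrightarrow> chart_inv c x \<in> fst c"
  unfolding chart_inv_def by (rule inv_into_into)

lemma chart_chart_inv: "x \<in> snd c ` fst c \<Longrightarrow> snd c (chart_inv c x) = x"
  unfolding chart_inv_def by (rule f_inv_into_f)

lemma open_chart_image:
  assumes "openin (topo M) U"
  shows "open (snd c ` (U \<inter> fst c))"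
proof -
  have "openin (subtopology (topo M) (fst c)) (U \<inter> fst c)"
    using assms by (rule openin_subtopology_Int)
  then have "openin (top_of_set (snd c ` fst c)) (snd c ` (U \<inter> fst c))"
    using homeomorphic_imp_open_map[OF chart_homeo] by (simp add: open_map_def)
  then show ?thesis
    using chart_image_open openin_open_trans by blast
qed

lemma open_chart_preimage:
  assumes "open T"
  shows "openin (topo M) {q \<in> fst c. snd c q \<in> T}"
proof -
  have cont: "continuous_map (subtopology (topo M) (fst c)) (top_of_set (snd c ` fst c)) (snd c)"
    by (rule homeomorphic_imp_continuous_map[OF chart_homeo])
  have "openin (top_of_set (snd c ` fst c)) (snd c ` fst c \<inter> T)"
    using assms by (rule openin_open_Int)
  from openin_continuous_map_preimage[OF cont this]
  have "openin (subtopology (topo M) (fst c)) {q \<in> fst c. snd c q \<in> T}"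
    unfolding topspace_chart by (rule back_subst[of "openin _"]) auto
  then show ?thesis
    using openin_trans_full chart_open by blast
qed

lemma smooth_at_coord:
  assumes "smooth_at M p f" "p \<in> fst c"
  shows "f \<circ> chart_inv c differentiable at (snd c p)"
proof -
  obtain U where U: "openin (topo M) U" "p \<in> U" "smooth_fun_on M U f"
    using assms(1) unfolding smooth_at_def by blast
  then have "smooth_on (snd c ` (U \<inter> fst c)) (f \<circ> chart_inv c)"
    using c unfolding smooth_fun_on_def by blast
  then show ?thesis
    using smooth_on_differentiable U(2) assms(2) by blast
qed

end

lemma smooth_fun_on_subset: "smooth_fun_on M U f \<Longrightarrow> V \<subseteq> U \<Longrightarrow> smooth_fun_on M V f"
  unfolding smooth_fun_on_def by (meson Int_mono image_mono order_refl smooth_on_subset)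

lemma smooth_at_both:
  assumes "smooth_at M p f" "smooth_at M p g"
  obtains U where "openin (topo M) U" "p \<in> U" "smooth_fun_on M U f" "smooth_fun_on M U g"
proof -
  obtain U V where "openin (topo M) U" "p \<in> U" "smooth_fun_on M U f"
    "openin (topo M) V" "p \<in> V" "smooth_fun_on M V g"
    using assms unfolding smooth_at_def by blast
  then show ?thesis
    by (intro that[of "U \<inter> V"]) (auto intro: smooth_fun_on_subset openin_Int)
qed

lemma smooth_at_linear:
  assumes "smooth_at M p f" "smooth_at M p g"
  shows "smooth_at M p (\<lambda>q. a * f q + g q)"
proof -
  obtain U where U: "openin (topo M) U" "p \<in> U" "smooth_fun_on M U f" "smooth_fun_on M U g"
    using smooth_at_both[OF assms] .
  have "smooth_fun_on M U (\<lambda>q. a * f q + g q)"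
    unfolding smooth_fun_on_def o_def
  proof
    fix c assume c: "c \<in> atlas M"
    show "smooth_on (snd c ` (U \<inter> fst c)) (\<lambda>x. a * f (chart_inv c x) + g (chart_inv c x))"
      using U(3,4) c open_chart_image[OF c U(1)] unfolding smooth_fun_on_def o_def
      by (intro smooth_on_add smooth_on_mult smooth_on_const) auto
  qed
  then show ?thesis using U unfolding smooth_at_def by blast
qed

lemma smooth_at_mult:
  assumes "smooth_at M p f" "smooth_at M p g"
  shows "smooth_at M p (\<lambda>q. f q * g q)"
proof -
  obtain U where U: "openin (topo M) U" "p \<in> U" "smooth_fun_on M U f" "smooth_fun_on M U g"
    using smooth_at_both[OF assms] .
  have "smooth_fun_on M U (\<lambda>q. f q * g q)"
    unfolding smooth_fun_on_def o_def
  proof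
    fix c assume c: "c \<in> atlas M"
    show "smooth_on (snd c ` (U \<inter> fst c)) (\<lambda>x. f (chart_inv c x) * g (chart_inv c x))"
      using U(3,4) c open_chart_image[OF c U(1)] unfolding smooth_fun_on_def o_def
      by (intro smooth_on_mult) auto
  qed
  then show ?thesis using U unfolding smooth_at_def by blast
qed

section \<open>Coordinate vectors as tangent vectors\<close>

context
  fixes c p assumes c: "c \<in> atlas M" and p: "p \<in> fst c"
begin

text \<open>The smoothness guard in \<open>coord_vec\<close> respects the derivation rules because
  smoothness near \<open>p\<close> is preserved by sums and products.\<close>

lemma coord_vec_tangent: "coord_vec M c p v \<in> tangent_space M p"
proof -
  have "dd v ((\<lambda>q. a * f q + g q) \<circ> chart_inv c) (snd c p)
      = a * dd v (f \<circ> chart_inv c) (snd c p) + dd v (g \<circ> chart_inv c) (snd c p)"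
    "dd v ((\<lambda>q. f q * g q) \<circ> chart_inv c) (snd c p)
      = f p * dd v (g \<circ> chart_inv c) (snd c p) + g p * dd v (f \<circ> chart_inv c) (snd c p)"
    if "smooth_at M p f" "smooth_at M p g" for f g a
  proof -
    note d = smooth_at_coord[OF c that(1) p] smooth_at_coord[OF c that(2) p]
    have "dd v (\<lambda>x. a * \<phi> x + \<psi> x) y = a * dd v \<phi> y + dd v \<psi> y"
      if "\<phi> differentiable at y" "\<psi> differentiable at y" for \<phi> \<psi> and y :: 'e
      using that by (simp add: dd_add differentiable_linear[OF bounded_linear_mult_right]
          dd_linear[OF bounded_linear_mult_right])
    from this[OF d] show "dd v ((\<lambda>q. a * f q + g q) \<circ> chart_inv c) (snd c p)
      = a * dd v (f \<circ> chart_inv c) (snd c p) + dd v (g \<circ> chart_inv c) (snd c p)"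
      by (simp add: o_def)
    have "dd v (\<lambda>x. \<phi> x * \<psi> x) y = \<phi> y * dd v \<psi> y + \<psi> y * dd v \<phi> y"
      if "\<phi> differentiable at y" "\<psi> differentiable at y" for \<phi> \<psi> :: "'e \<Rightarrow> real" and y
      using that by (simp add: dd_bilinear[OF bounded_bilinear_mult])
    from this[OF d]
    show "dd v ((\<lambda>q. f q * g q) \<circ> chart_inv c) (snd c p)
      = f p * dd v (g \<circ> chart_inv c) (snd c p) + g p * dd v (f \<circ> chart_inv c) (snd c p)"
      by (simp add: o_def chart_inv_chart[OF c p])
  qed
  then show ?thesis
    unfolding tangent_space_def coord_vec_def by (simp add: smooth_at_linear smooth_at_mult)
qed

lemma coord_vec_linear:
  "coord_vec M c p (a *\<^sub>R u + v) = (\<lambda>f. a * coord_vec M c p u f + coord_vec M c p v f)"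
  unfolding coord_vec_def
  using smooth_at_coord[OF c _ p] by (auto simp: dd_direction_add dd_direction_scale fun_eq_iff)

text \<open>The coordinate function \<open>snd c q \<bullet> v\<close> has derivative
  \<open>v \<bullet> v\<close> along \<open>v\<close>. This yields definiteness of the metric in
  coordinates.\<close>

lemma coord_vec_nonzero:
  assumes v: "v \<noteq> 0"
  shows "coord_vec M c p v \<noteq> (\<lambda>f. 0)"
proof
  assume 0: "coord_vec M c p v = (\<lambda>f. 0)"
  let ?f = "\<lambda>q. snd c q \<bullet> v"
  \<comment> \<open>In another chart the test function is a component of the transition map.\<close>
  have "smooth_on (snd d ` (fst c \<inter> fst d)) (?f \<circ> chart_inv d)" if d: "d \<in> atlas M" for d
  proof -
    have "smooth_on (snd d ` (fst d \<inter> fst c)) (snd c \<circ> chart_inv d)"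
      using smooth_manifold c d unfolding smooth_manifold_def by blast
    then have "smooth_on (snd d ` (fst c \<inter> fst d)) (snd c \<circ> chart_inv d)"
      by (simp add: Int_commute)
    from smooth_on_inner[OF open_chart_image[OF d chart_open[OF c]] this smooth_on_const[of _ v]]
    show ?thesis by (simp add: o_def)
  qed
  then have "smooth_at M p ?f"
    unfolding smooth_at_def smooth_fun_on_def using chart_open[OF c] p by blast
  then have "dd v (?f \<circ> chart_inv c) (snd c p) = 0"
    using fun_cong[OF 0, of ?f] by (simp add: coord_vec_def)
  moreover have "dd v (?f \<circ> chart_inv c) (snd c p) = dd v (\<lambda>x. x \<bullet> v) (snd c p)"
    using p chart_image_open[OF c] by (intro dd_cong[of "snd c ` fst c"]) (auto simp: chart_inv_chart[OF c])
  moreover have "dd v (\<lambda>x. x \<bullet> v) (snd c p) = v \<bullet> v"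
    using dd_inner_const[of "\<lambda>x. x" "snd c p" v v] by simp
  ultimately show False using v by simp
qed

end

lemma coordinate_metric:
  assumes g: "riemannian_metric M g" and c: "c \<in> atlas M"
  shows "coordinate_metric (snd c ` fst c) (metric_in M g c)"
proof (rule coordinate_metric.intro)
  show "open (snd c ` fst c)" by (rule chart_image_open[OF c])
  show "smooth_on (snd c ` fst c) (\<lambda>x. metric_in M g c x i j)" if "i \<in> Basis" "j \<in> Basis" for i j
    using g c that unfolding riemannian_metric_def by blast
  fix x assume x: "x \<in> snd c ` fst c"
  let ?p = "chart_inv c x"
  have p: "?p \<in> fst c" by (rule chart_inv_in[OF c x])
  have "?p \<in> points M" using p chart_subset[OF c] by blast
  with g have sym: "\<And>X Y. X \<in> tangent_space M ?p \<Longrightarrow> Y \<in> tangent_space M ?p \<Longrightarrow> g ?p X Y = g ?p Y X"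
    and lin: "\<And>X Y Z a. X \<in> tangent_space M ?p \<Longrightarrow> Y \<in> tangent_space M ?p \<Longrightarrow> Z \<in> tangent_space M ?p
      \<Longrightarrow> g ?p (\<lambda>f. a * X f + Y f) Z = a * g ?p X Z + g ?p Y Z"
    and pos: "\<And>X. X \<in> tangent_space M ?p \<Longrightarrow> X \<noteq> (\<lambda>f. 0) \<Longrightarrow> g ?p X X > 0"
    unfolding riemannian_metric_def by blast+
  note tan = coord_vec_tangent[OF c p]
  show "metric_in M g c x u v = metric_in M g c x v u" for u v
    unfolding metric_in_def by (rule sym[OF tan tan])
  show "metric_in M g c x v v > 0" if "v \<noteq> 0" for v
    unfolding metric_in_def using pos[OF tan coord_vec_nonzero[OF c p that]] .
  have comb: "metric_in M g c x (a *\<^sub>R u + w) v = a * metric_in M g c x u v + metric_in M g c x w v" for a u w v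
    unfolding metric_in_def coord_vec_linear[OF c p] by (rule lin[OF tan tan tan])
  show "linear (\<lambda>u. metric_in M g c x u v)" for v
  proof (rule linearI)
    show "metric_in M g c x (u + w) v = metric_in M g c x u v + metric_in M g c x w v" for u w
      using comb[of 1 u w v] by simp
    have "metric_in M g c x 0 v = 0" using comb[of 1 0 0 v] by simp
    then show "metric_in M g c x (a *\<^sub>R u) v = a *\<^sub>R metric_in M g c x u v" for a u
      using comb[of a u 0 v] by simp
  qed
qed

end


section \<open>Product charts and the warped metric in them\<close>

locale product_of_manifolds =
  B: smooth_manifold_locale B + F: smooth_manifold_locale F
  for B :: "('p, 'a::euclidean_space) manifold" and F :: "('q, 'b::euclidean_space) manifold"
begin

abbreviation prod_chart :: "('p, 'a) chart \<Rightarrow> ('q, 'b) chart \<Rightarrow> ('p \<times> 'q, 'a \<times> 'b) chart" where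
  "prod_chart c d \<equiv> (fst c \<times> fst d, map_prod (snd c) (snd d))"

lemma atlas_product: "atlas (product_manifold B F) = {prod_chart c d |c d. c \<in> atlas B \<and> d \<in> atlas F}"
  by (simp add: product_manifold_def)

lemma chart_inv_prod:
  assumes c: "c \<in> atlas B" and d: "d \<in> atlas F" and xy: "x \<in> snd c ` fst c" "y \<in> snd d ` fst d"
  shows "chart_inv (prod_chart c d) (x, y) = (chart_inv c x, chart_inv d y)"
proof -
  have "inj_on (map_prod (snd c) (snd d)) (fst c \<times> fst d)"
    by (rule map_prod_inj_on[OF B.chart_inj[OF c] F.chart_inj[OF d]])
  moreover have "(chart_inv c x, chart_inv d y) \<in> fst c \<times> fst d"
    "map_prod (snd c) (snd d) (chart_inv c x, chart_inv d y) = (x, y)"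
    using xy by (auto simp: B.chart_inv_in[OF c] F.chart_inv_in[OF d]
        B.chart_chart_inv[OF c] F.chart_chart_inv[OF d])
  ultimately show ?thesis
    unfolding chart_inv_def by (simp add: inv_into_f_eq)
qed

text \<open>Ensures that the guard in \<open>coord_vec\<close> does not annihilate functions pulled
  back from the base.\<close>

lemma smooth_at_fst:
  assumes "smooth_at B p f" "q \<in> points F"
  shows "smooth_at (product_manifold B F) (p, q) (f \<circ> fst)"
proof -
  obtain U where U: "openin (topo B) U" "p \<in> U" "smooth_fun_on B U f"
    using assms(1) unfolding smooth_at_def by blast
  have "openin (topo (product_manifold B F)) (U \<times> points F)"
    using U(1) by (simp add: product_manifold_def openin_prod_Times_iff)
  moreover have "smooth_fun_on (product_manifold B F) (U \<times> points F) (f \<circ> fst)"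
    unfolding smooth_fun_on_def atlas_product
  proof clarify
    fix c d assume c: "c \<in> atlas B" and d: "d \<in> atlas F"
    let ?S = "snd c ` (U \<inter> fst c) \<times> snd d ` (points F \<inter> fst d)"
    have eq: "snd (prod_chart c d) ` (U \<times> points F \<inter> fst (prod_chart c d)) = ?S"
      by (auto simp: map_prod_def image_iff)
    have o: "open (snd c ` (U \<inter> fst c))" "open ?S"
      using B.open_chart_image[OF c U(1)] F.open_chart_image[OF d openin_topspace]
      by (auto intro: open_Times)
    have "smooth_on (snd c ` (U \<inter> fst c)) (f \<circ> chart_inv c)"
      using U(3) c unfolding smooth_fun_on_def by blast
    then have "smooth_on ?S (\<lambda>z. (f \<circ> chart_inv c) (fst z))"
      by (rule smooth_on_compose_linear[OF bounded_linear_fst o, rotated]) auto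
    then have "smooth_on ?S (f \<circ> fst \<circ> chart_inv (prod_chart c d))"
      by (subst smooth_on_cong[OF o(2), of _ "\<lambda>z. (f \<circ> chart_inv c) (fst z)"])
         (auto simp: chart_inv_prod[OF c d])
    then show "smooth_on (snd (prod_chart c d) ` (U \<times> points F \<inter> fst (prod_chart c d)))
        (f \<circ> fst \<circ> chart_inv (prod_chart c d))"
      unfolding eq .
  qed
  ultimately show ?thesis
    unfolding smooth_at_def using U(2) assms(2) by blast
qed

lemma smooth_at_snd:
  assumes "smooth_at F q f" "p \<in> points B"
  shows "smooth_at (product_manifold B F) (p, q) (f \<circ> snd)"
proof -
  obtain U where U: "openin (topo F) U" "q \<in> U" "smooth_fun_on F U f"
    using assms(1) unfolding smooth_at_def by blast
  have "openin (topo (product_manifold B F)) (points B \<times> U)"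
    using U(1) by (simp add: product_manifold_def openin_prod_Times_iff)
  moreover have "smooth_fun_on (product_manifold B F) (points B \<times> U) (f \<circ> snd)"
    unfolding smooth_fun_on_def atlas_product
  proof clarify
    fix c d assume c: "c \<in> atlas B" and d: "d \<in> atlas F"
    let ?S = "snd c ` (points B \<inter> fst c) \<times> snd d ` (U \<inter> fst d)"
    have eq: "snd (prod_chart c d) ` (points B \<times> U \<inter> fst (prod_chart c d)) = ?S"
      by (auto simp: map_prod_def image_iff)
    have o: "open (snd d ` (U \<inter> fst d))" "open ?S"
      using F.open_chart_image[OF d U(1)] B.open_chart_image[OF c openin_topspace]
      by (auto intro: open_Times)
    have "smooth_on (snd d ` (U \<inter> fst d)) (f \<circ> chart_inv d)"
      using U(3) d unfolding smooth_fun_on_def by blast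
    then have "smooth_on ?S (\<lambda>z. (f \<circ> chart_inv d) (snd z))"
      by (rule smooth_on_compose_linear[OF bounded_linear_snd o, rotated]) auto
    then have "smooth_on ?S (f \<circ> snd \<circ> chart_inv (prod_chart c d))"
      by (subst smooth_on_cong[OF o(2), of _ "\<lambda>z. (f \<circ> chart_inv d) (snd z)"])
         (auto simp: chart_inv_prod[OF c d])
    then show "smooth_on (snd (prod_chart c d) ` (points B \<times> U \<inter> fst (prod_chart c d)))
        (f \<circ> snd \<circ> chart_inv (prod_chart c d))"
      unfolding eq .
  qed
  ultimately show ?thesis
    unfolding smooth_at_def using U(2) assms(2) by blast
qed

context
  fixes c d p q
  assumes c: "c \<in> atlas B" and d: "d \<in> atlas F" and p: "p \<in> fst c" and q: "q \<in> fst d"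
begin

text \<open>On functions not smooth near \<open>p\<close> both sides are zero by convention;
  elsewhere this is the chain rule in a product chart.\<close>

lemma pushforward_fst:
  "pushforward B fst (p, q) (coord_vec (product_manifold B F) (prod_chart c d) (p, q) u) = coord_vec B c p (fst u)"
proof (rule ext)
  fix f
  show "pushforward B fst (p, q) (coord_vec (product_manifold B F) (prod_chart c d) (p, q) u) f = coord_vec B c p (fst u) f"
  proof (cases "smooth_at B p f")
    case True
    have q': "q \<in> points F" using F.chart_subset[OF d] q by blast
    have "dd u (f \<circ> fst \<circ> chart_inv (prod_chart c d)) (snd c p, snd d q)
        = dd u (\<lambda>z. (f \<circ> chart_inv c) (fst z)) (snd c p, snd d q)"
      by (rule dd_cong[of "snd c ` fst c \<times> snd d ` fst d"])
         (use p q in \<open>auto intro: open_Times B.chart_image_open[OF c] F.chart_image_open[OF d]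
            simp: chart_inv_prod[OF c d]\<close>)
    also have "\<dots> = dd (fst u) (f \<circ> chart_inv c) (snd c p)"
      using B.smooth_at_coord[OF c True p] by (subst dd_fst) simp_all
    finally show ?thesis
      using True smooth_at_fst[OF True q'] by (simp add: pushforward_def coord_vec_def)
  qed (simp add: pushforward_def coord_vec_def)
qed

lemma pushforward_snd:
  "pushforward F snd (p, q) (coord_vec (product_manifold B F) (prod_chart c d) (p, q) u) = coord_vec F d q (snd u)"
proof (rule ext)
  fix f
  show "pushforward F snd (p, q) (coord_vec (product_manifold B F) (prod_chart c d) (p, q) u) f = coord_vec F d q (snd u) f"
  proof (cases "smooth_at F q f")
    case True
    have p': "p \<in> points B" using B.chart_subset[OF c] p by blast
    have "dd u (f \<circ> snd \<circ> chart_inv (prod_chart c d)) (snd c p, snd d q)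
        = dd u (\<lambda>z. (f \<circ> chart_inv d) (snd z)) (snd c p, snd d q)"
      by (rule dd_cong[of "snd c ` fst c \<times> snd d ` fst d"])
         (use p q in \<open>auto intro: open_Times B.chart_image_open[OF c] F.chart_image_open[OF d]
            simp: chart_inv_prod[OF c d]\<close>)
    also have "\<dots> = dd (snd u) (f \<circ> chart_inv d) (snd d q)"
      using F.smooth_at_coord[OF d True q] by (subst dd_snd) simp_all
    finally show ?thesis
      using True smooth_at_snd[OF True p'] by (simp add: pushforward_def coord_vec_def)
  qed (simp add: pushforward_def coord_vec_def)
qed

end

lemma metric_in_warped:
  assumes c: "c \<in> atlas B" and d: "d \<in> atlas F" and x: "x \<in> snd c ` fst c" and y: "y \<in> snd d ` fst d"
  shows "metric_in (product_manifold B F) (warped_metric B F f gB gF) (prod_chart c d) (x, y) u v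
    = metric_in B gB c x (fst u) (fst v)
      + ((f \<circ> chart_inv c) x)\<^sup>2 * metric_in F gF d y (snd u) (snd v)"
  using B.chart_inv_in[OF c x] F.chart_inv_in[OF d y]
  by (simp add: metric_in_def warped_metric_def pullback_def chart_inv_prod[OF c d x y]
      pushforward_fst[OF c d] pushforward_snd[OF c d])

end


theorem theorem2p8:
  fixes B :: "('p, 'a::euclidean_space) manifold" and gB :: "'p metric"
    and F :: "('q, 'b::euclidean_space) manifold" and gF :: "'q metric"
    and f :: "'p \<Rightarrow> real" and h :: "'p \<times> 'q \<Rightarrow> real" and \<rho> c :: real
  assumes "warped_product_yamabe_gradient_soliton B gB F gF f h \<rho>"
    and "\<not> compact_space (topo B)"
    and "c \<noteq> 0"
    and "\<forall>\<phi>\<in>atlas B. \<forall>p\<in>fst \<phi>. \<forall>i\<in>Basis. \<forall>j\<in>Basis.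
           hessian B gB f \<phi> p i j = c * f p * gB p (coord_vec B \<phi> p i) (coord_vec B \<phi> p j)"
  shows "trivial_yamabe_gradient_soliton (product_manifold B F) (warped_metric B F f gB gF) h \<rho> \<and>
         constant_scalar_curvature (product_manifold B F) (warped_metric B F f gB gF)"
proof -
  let ?M = "product_manifold B F" and ?g = "warped_metric B F f gB gF"
  have sol: "yamabe_gradient_soliton ?M ?g h \<rho>"
    and B: "smooth_manifold B" "riemannian_metric B gB" and F: "smooth_manifold F" "riemannian_metric F gF"
    and f: "smooth_fun_on B (points B) f" "\<And>p. p \<in> points B \<Longrightarrow> f p > 0"
    using assms(1) unfolding warped_product_yamabe_gradient_soliton_def riemannian_manifold_def by auto
  have M: "smooth_manifold ?M" "riemannian_metric ?M ?g" "connected_space (topo ?M)"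
    and h: "smooth_fun_on ?M (points ?M) h"
    and hess_h: "\<And>e p i j. e \<in> atlas ?M \<Longrightarrow> p \<in> fst e \<Longrightarrow> i \<in> Basis \<Longrightarrow> j \<in> Basis \<Longrightarrow>
        hessian ?M ?g h e p i j = (scalar_curvature ?M ?g e p - \<rho>) * ?g p (coord_vec ?M e p i) (coord_vec ?M e p j)"
    using sol unfolding yamabe_gradient_soliton_def riemannian_manifold_def by auto
  interpret product_of_manifolds B F
    by unfold_locales (rule B F)+
  interpret M: smooth_manifold_locale ?M
    by unfold_locales (rule M)
  have local: "dd u (h \<circ> chart_inv e) x = 0" "coord_scalar (metric_in ?M ?g e) x = \<rho>"
    "smooth_on (snd e ` fst e) (h \<circ> chart_inv e)"
    if e: "e \<in> atlas ?M" and x: "x \<in> snd e ` fst e" for e x u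
  proof -
    obtain \<phi> \<psi> where \<phi>: "\<phi> \<in> atlas B" and \<psi>: "\<psi> \<in> atlas F" and e_eq: "e = prod_chart \<phi> \<psi>"
      using e unfolding atlas_product by blast
    let ?SB = "snd \<phi> ` fst \<phi>" and ?SF = "snd \<psi> ` fst \<psi>"
    have S: "snd e ` fst e = ?SB \<times> ?SF"
      unfolding e_eq by (auto simp: map_prod_def image_iff)
    have "smooth_on (snd e ` (points ?M \<inter> fst e)) (h \<circ> chart_inv e)"
      using h e unfolding smooth_fun_on_def by blast
    moreover have "points ?M \<inter> fst e = fst e" using M.chart_subset[OF e] by blast
    ultimately show smooth_h: "smooth_on (snd e ` fst e) (h \<circ> chart_inv e)" by simp
    have "smooth_on (snd \<phi> ` (points B \<inter> fst \<phi>)) (f \<circ> chart_inv \<phi>)"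
      using f(1) \<phi> unfolding smooth_fun_on_def by blast
    moreover have "points B \<inter> fst \<phi> = fst \<phi>" using B.chart_subset[OF \<phi>] by blast
    ultimately have smooth_f: "smooth_on ?SB (f \<circ> chart_inv \<phi>)" by simp
    have "conformal_hessian ?SB (metric_in B gB \<phi>) (f \<circ> chart_inv \<phi>) (\<lambda>x. c * (f \<circ> chart_inv \<phi>) x)"
    proof (rule coordinate_metric.conformal_hessianI[OF B.coordinate_metric[OF B(2) \<phi>] smooth_f])
      fix x i j assume "x \<in> ?SB" and ij: "i \<in> (Basis :: 'a set)" "j \<in> (Basis :: 'a set)"
      then obtain p where p: "p \<in> fst \<phi>" "x = snd \<phi> p" by blast
      then show "coord_hessian (metric_in B gB \<phi>) (f \<circ> chart_inv \<phi>) x i j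
          = c * (f \<circ> chart_inv \<phi>) x * metric_in B gB \<phi> x i j"
        using bspec[OF bspec[OF bspec[OF bspec[OF assms(4) \<phi>] p(1)] ij(1)] ij(2)]
        by (simp add: hessian_def metric_in_def B.chart_inv_chart[OF \<phi>])
    qed
    moreover have "conformal_hessian (?SB \<times> ?SF) (metric_in ?M ?g e) (h \<circ> chart_inv e)
        (\<lambda>x. coord_scalar (metric_in ?M ?g e) x - \<rho>)"
      unfolding S[symmetric]
    proof (rule coordinate_metric.conformal_hessianI[OF M.coordinate_metric[OF M(2) e] smooth_h])
      fix x i j assume "x \<in> snd e ` fst e" and ij: "i \<in> (Basis :: ('a \<times> 'b) set)" "j \<in> (Basis :: ('a \<times> 'b) set)"
      then obtain p where p: "p \<in> fst e" "x = snd e p" by blast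
      then show "coord_hessian (metric_in ?M ?g e) (h \<circ> chart_inv e) x i j
          = (coord_scalar (metric_in ?M ?g e) x - \<rho>) * metric_in ?M ?g e x i j"
        using hess_h[OF e p(1) ij]
        by (simp add: hessian_def scalar_curvature_def metric_in_def M.chart_inv_chart[OF e])
    qed
    ultimately interpret warped_hessian ?SB "metric_in B gB \<phi>" "f \<circ> chart_inv \<phi>" c ?SF "metric_in F gF \<psi>"
      "metric_in ?M ?g e" "h \<circ> chart_inv e" "\<lambda>x. coord_scalar (metric_in ?M ?g e) x - \<rho>"
    proof (intro warped_hessian.intro warped_hessian_axioms.intro)
      show "coordinate_metric ?SF (metric_in F gF \<psi>)" by (rule F.coordinate_metric[OF F(2) \<psi>])
      show "(f \<circ> chart_inv \<phi>) y > 0" if "y \<in> ?SB" for y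
        using f(2) B.chart_inv_in[OF \<phi> that] B.chart_subset[OF \<phi>] by auto
      show "metric_in ?M ?g e p u v = metric_in B gB \<phi> (fst p) (fst u) (fst v)
          + ((f \<circ> chart_inv \<phi>) (fst p))\<^sup>2 * metric_in F gF \<psi> (snd p) (snd u) (snd v)"
        if "p \<in> ?SB \<times> ?SF" for p u v
        using that metric_in_warped[OF \<phi> \<psi>, of "fst p" "snd p" f gB gF u v] unfolding e_eq by auto
    qed
    \<comment> \<open>In this instance \<open>\<sigma>\<close> is literally the scalar curvature
      minus \<open>\<rho>\<close>, so \<open>refl\<close> proves that premise.\<close>
    show "dd u (h \<circ> chart_inv e) x = 0" "coord_scalar (metric_in ?M ?g e) x = \<rho>"
      using trivial_soliton[OF assms(3) refl] x unfolding S by auto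
  qed
  have "h constant_on points ?M"
  proof (rule locally_constant_imp_constant_on[OF M(3)])
    fix p assume "p \<in> points ?M"
    then obtain e where e: "e \<in> atlas ?M" and p: "p \<in> fst e"
      using M(1) unfolding smooth_manifold_def by blast
    \<comment> \<open>A ball is needed because the chart image may be disconnected, where a
      vanishing derivative does not force a single value.\<close>
    obtain r where r: "r > 0" "ball (snd e p) r \<subseteq> snd e ` fst e"
      using M.chart_image_open[OF e] p openE by (metis imageI)
    have "(h \<circ> chart_inv e has_derivative (\<lambda>u. 0)) (at x within ball (snd e p) r)"
      if "x \<in> ball (snd e p) r" for x
    proof -
      have x: "x \<in> snd e ` fst e" using that r(2) by blast
      have "(h \<circ> chart_inv e has_derivative (\<lambda>u. dd u (h \<circ> chart_inv e) x)) (at x)"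
        using smooth_on_differentiable[OF local(3)[OF e x] x] by (simp add: frechet_derivative_works)
      then show ?thesis
        using local(1)[OF e x] by (simp add: has_derivative_at_withinI)
    qed
    then have "\<exists>k. \<forall>x\<in>ball (snd e p) r. (h \<circ> chart_inv e) x = k"
      by (rule has_derivative_zero_constant[OF convex_ball])
    then obtain k where k: "\<forall>x\<in>ball (snd e p) r. (h \<circ> chart_inv e) x = k" ..
    have val: "h q = k" if "q \<in> fst e" "snd e q \<in> ball (snd e p) r" for q
      using bspec[OF k that(2)] by (simp add: M.chart_inv_chart[OF e that(1)])
    define U where "U = {q \<in> fst e. snd e q \<in> ball (snd e p) r}"
    have "openin (topo ?M) U" unfolding U_def by (rule M.open_chart_preimage[OF e open_ball])
    moreover have "p \<in> U" using p r(1) by (simp add: U_def)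
    moreover have "h q = h p" if "q \<in> U" for q
      using val[of q] val[OF p] that r(1) by (simp add: U_def)
    ultimately show "\<exists>U. openin (topo ?M) U \<and> p \<in> U \<and> (\<forall>q\<in>U. h q = h p)"
      by (intro exI[of _ U] conjI ballI)
  qed
  moreover have "scalar_curvature ?M ?g e p = \<rho>" if "e \<in> atlas ?M" "p \<in> fst e" for e p
    using local(2)[OF that(1)] that(2) by (simp add: scalar_curvature_def)
  ultimately show ?thesis
    using sol unfolding trivial_yamabe_gradient_soliton_def constant_scalar_curvature_def
    by (intro conjI exI[of _ \<rho>] ballI)
qed

end
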